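(* Let $p=n\ge2$, let $\Omega\subset\mathbb R^n$ be a bounded Lipschitz domain, $0<T<\infty$, $\Omega_T:=\Omega\times(0,T)$, let $x_0\in\Omega$ and let $J\Subset(0,T)$ be an open nondegenerate interval. Define the product measure $\mu:=\delta_{x_0}\otimes\mathcal L^1\llcorner J$. Then $\mu$ is a finite positive Radon measure on $\Omega_T$, and for every $q>1$, every $z\in\Omega_T$ and every $r>0$, $$\mu\bigl(Q_{r,r^q}(z)\cap\Omega_T\bigr)\le 2r^q .$$ In particular, for every $q\ge p$ there is $M>0$ such that $\mu(Q_{r,r^q}(z)\cap\Omega_T)\le M r^{n+q-\vartheta}$ for all $z\in\Omega_T$, $r>0$, with $\vartheta=p=\min\{p,q\}$. Nevertheless, $\mu\notin W_M'(\Omega_T)$.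
   Context: For $z=(x,t)\in\mathbb R^{n+1}$, $r>0$: $Q_{r,r^q}(z):=B_r(x)\times(t-r^q,t+r^q)$. $W^{-1,p'}(\Omega):=(W^{1,p}_0(\Omega))'$, $p'=p/(p-1)$, and $$W_M(\Omega_T):=\{u\in L^p(0,T;W_0^{1,p}(\Omega))\cap L^\infty(0,T;L^2(\Omega)):\ \partial_tu\in L^{p'}(0,T;W^{-1,p'}(\Omega))\},$$ with norm $\|u\|_{W_M}:=\|\nabla u\|_{L^p(\Omega_T)}+\|\partial_tu\|_{L^{p'}(0,T;W^{-1,p'}(\Omega))}+\|u\|_{L^\infty(0,T;L^2(\Omega))}$. Let $\mathscr D:=C_c^\infty(\Omega\times\mathbb R)|_{\Omega_T}$ (restrictions to $\Omega_T$), which is dense in $W_M(\Omega_T)$. A finite Radon measure $\mu$ on $\Omega_T$ belongs to $W_M'(\Omega_T)$ if it defines a continuous linear functional there, i.e. there is $C$ with $|\int_{\Omega_T}\varphi\,d\mu|\le C\|\varphi\|_{W_M}$ for all $\varphi\in\mathscr D$. *)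

theory Defs
  imports "HOL-Probability.Probability"
begin

section \<open>Domains, cylinders and Radon measures\<close>

text \<open>Near each boundary point, and after the rotation that takes the unit vector \<open>e\<close> to the last
  coordinate direction, the domain is the strict epigraph of a Lipschitz function \<open>\<gamma>\<close> on the
  hyperplane orthogonal to \<open>e\<close>.\<close>

definition lipschitz_boundary :: "'a::euclidean_space set \<Rightarrow> bool" where
  "lipschitz_boundary \<Omega> \<longleftrightarrow>
     (\<forall>y\<in>frontier \<Omega>. \<exists>U e \<gamma> L. open U \<and> y \<in> U \<and> norm e = 1 \<and>
        L-lipschitz_on {v. v \<bullet> e = 0} (\<gamma> :: 'a \<Rightarrow> real) \<and>
        \<Omega> \<inter> U = {x \<in> U. x \<bullet> e > \<gamma> (x - (x \<bullet> e) *\<^sub>R e)})"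

definition bounded_lipschitz_domain :: "'a::euclidean_space set \<Rightarrow> bool" where
  "bounded_lipschitz_domain \<Omega> \<longleftrightarrow>
     open \<Omega> \<and> connected \<Omega> \<and> \<Omega> \<noteq> {} \<and> bounded \<Omega> \<and> lipschitz_boundary \<Omega>"

definition parabolic_domain :: "'a set \<Rightarrow> real \<Rightarrow> ('a \<times> real) set" where
  "parabolic_domain \<Omega> T = \<Omega> \<times> {0<..<T}"

definition cylinder :: "real \<Rightarrow> real \<Rightarrow> 'a::euclidean_space \<times> real \<Rightarrow> ('a \<times> real) set" where
  "cylinder r s z = ball (fst z) r \<times> {snd z - s<..<snd z + s}"

text \<open>A finite Borel measure on the subspace \<open>X\<close> that is inner regular with respect to compact sets.\<close>

definition finite_radon_measure_on :: "'a::topological_space set \<Rightarrow> 'a measure \<Rightarrow> bool" where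
  "finite_radon_measure_on X \<mu> \<longleftrightarrow>
     sets \<mu> = sets (restrict_space borel X) \<and> finite_measure \<mu> \<and>
     (\<forall>B\<in>sets \<mu>. emeasure \<mu> B = (SUP K\<in>{K. K \<subseteq> B \<and> compact K}. emeasure \<mu> K))"


section \<open>Smooth functions with compact support\<close>

fun Ck :: "nat \<Rightarrow> ('a::euclidean_space \<Rightarrow> real) \<Rightarrow> bool" where
  "Ck 0 f \<longleftrightarrow> continuous_on UNIV f"
| "Ck (Suc k) f \<longleftrightarrow> (\<forall>x. f differentiable (at x)) \<and>
     (\<forall>v. Ck k (\<lambda>x. frechet_derivative f (at x) v))"

definition Cc_infinity :: "'a::euclidean_space set \<Rightarrow> ('a \<Rightarrow> real) set" where
  "Cc_infinity U = {\<phi>. (\<forall>k. Ck k \<phi>) \<and>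
     compact (closure {x. \<phi> x \<noteq> 0}) \<and> closure {x. \<phi> x \<noteq> 0} \<subseteq> U}"

definition grad :: "('a::euclidean_space \<Rightarrow> real) \<Rightarrow> 'a \<Rightarrow> 'a" where
  "grad \<phi> x = (\<Sum>b\<in>Basis. frechet_derivative \<phi> (at x) b *\<^sub>R b)"

definition time_deriv :: "('a::euclidean_space \<times> real \<Rightarrow> real) \<Rightarrow> 'a \<times> real \<Rightarrow> real" where
  "time_deriv \<phi> z = frechet_derivative \<phi> (at z) (0, 1)"

definition test_restrictions :: "'a::euclidean_space set \<Rightarrow> real \<Rightarrow> ('a \<times> real \<Rightarrow> real) set" where
  "test_restrictions \<Omega> T =
     (\<lambda>\<phi>. restrict \<phi> (parabolic_domain \<Omega> T)) ` Cc_infinity (\<Omega> \<times> UNIV)"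


section \<open>Lebesgue and Sobolev spaces\<close>

text \<open>Elements of Lebesgue and Sobolev spaces are represented by functions; the notions below
  depend only on almost-everywhere classes. Weak derivatives are unique only almost everywhere, so
  they are carried along as explicit arguments (\<open>G\<close> for the gradient, \<open>g\<close> for the time
  derivative) instead of being chosen.\<close>

definition Lp :: "'a measure \<Rightarrow> real \<Rightarrow> ('a \<Rightarrow> 'b::euclidean_space) \<Rightarrow> bool" where
  "Lp M p f \<longleftrightarrow> f \<in> borel_measurable M \<and> integrable M (\<lambda>x. norm (f x) powr p)"

definition Lp_norm :: "'a measure \<Rightarrow> real \<Rightarrow> ('a \<Rightarrow> 'b::euclidean_space) \<Rightarrow> real" where
  "Lp_norm M p f = (\<integral>x. norm (f x) powr p \<partial>M) powr (1 / p)"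

definition weak_gradient ::
    "'a::euclidean_space set \<Rightarrow> ('a \<Rightarrow> real) \<Rightarrow> ('a \<Rightarrow> 'a) \<Rightarrow> bool" where
  "weak_gradient \<Omega> w G \<longleftrightarrow> (\<forall>\<psi>\<in>Cc_infinity \<Omega>.
     (\<integral>x. w x *\<^sub>R grad \<psi> x \<partial>lebesgue_on \<Omega>) = - (\<integral>x. \<psi> x *\<^sub>R G x \<partial>lebesgue_on \<Omega>))"

text \<open>\<open>W1p \<Omega> p w G\<close>: \<open>w\<close> belongs to \<open>W\<^sup>1\<^sup>,\<^sup>p(\<Omega>)\<close> and has weak gradient \<open>G\<close>. \<open>W1p_0\<close> is the
  closure of the test functions in that space.\<close>

definition W1p ::
    "'a::euclidean_space set \<Rightarrow> real \<Rightarrow> ('a \<Rightarrow> real) \<Rightarrow> ('a \<Rightarrow> 'a) \<Rightarrow> bool" where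
  "W1p \<Omega> p w G \<longleftrightarrow>
     Lp (lebesgue_on \<Omega>) p w \<and> Lp (lebesgue_on \<Omega>) p G \<and> weak_gradient \<Omega> w G"

definition W1p_0 ::
    "'a::euclidean_space set \<Rightarrow> real \<Rightarrow> ('a \<Rightarrow> real) \<Rightarrow> ('a \<Rightarrow> 'a) \<Rightarrow> bool" where
  "W1p_0 \<Omega> p w G \<longleftrightarrow> W1p \<Omega> p w G \<and>
     (\<exists>\<phi> :: nat \<Rightarrow> 'a \<Rightarrow> real. (\<forall>k. \<phi> k \<in> Cc_infinity \<Omega>) \<and>
        (\<lambda>k. Lp_norm (lebesgue_on \<Omega>) p (\<lambda>x. \<phi> k x - w x)) \<longlonglongrightarrow> 0 \<and>
        (\<lambda>k. Lp_norm (lebesgue_on \<Omega>) p (\<lambda>x. grad (\<phi> k) x - G x)) \<longlonglongrightarrow> 0)"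

text \<open>The dual \<open>W\<^sup>-\<^sup>1\<^sup>,\<^sup>p\<^sup>'(\<Omega>)\<close>, where \<open>W\<^sub>0\<^sup>1\<^sup>,\<^sup>p(\<Omega>)\<close> has the norm
  \<open>w \<mapsto> \<parallel>\<nabla>w\<parallel>\<^sub>p\<close>. Linearity and the bound force equal values on functions that agree
  almost everywhere.\<close>

definition W1p_0_dual ::
    "'a::euclidean_space set \<Rightarrow> real \<Rightarrow> (('a \<Rightarrow> real) \<Rightarrow> real) \<Rightarrow> bool" where
  "W1p_0_dual \<Omega> p F \<longleftrightarrow>
     (\<forall>v H w G a b. W1p_0 \<Omega> p v H \<longrightarrow> W1p_0 \<Omega> p w G \<longrightarrow>
        F (\<lambda>x. a * v x + b * w x) = a * F v + b * F w) \<and>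
     (\<exists>C. \<forall>w G. W1p_0 \<Omega> p w G \<longrightarrow> \<bar>F w\<bar> \<le> C * Lp_norm (lebesgue_on \<Omega>) p G)"

definition dual_norm ::
    "'a::euclidean_space set \<Rightarrow> real \<Rightarrow> (('a \<Rightarrow> real) \<Rightarrow> real) \<Rightarrow> real" where
  "dual_norm \<Omega> p F =
     Sup {\<bar>F w\<bar> | w G. W1p_0 \<Omega> p w G \<and> Lp_norm (lebesgue_on \<Omega>) p G \<le> 1}"

definition conj_exp :: "real \<Rightarrow> real" where
  "conj_exp p = p / (p - 1)"


section \<open>The parabolic space \<open>W\<^sub>M\<close> and its dual\<close>

text \<open>The three Bochner spaces. The target spaces \<open>W\<^sub>0\<^sup>1\<^sup>,\<^sup>p\<close>, \<open>L\<^sup>2\<close> and \<open>W\<^sup>-\<^sup>1\<^sup>,\<^sup>p\<^sup>'\<close> are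
  separable for \<open>1 < p < \<infinity>\<close>, so by Pettis' theorem strong measurability in \<open>t\<close> is expressed by joint
  measurability of \<open>u\<close> and \<open>G\<close> in \<open>(x, t)\<close>, and by measurability of \<open>t \<mapsto> g t w\<close> for every \<open>w\<close>.\<close>

definition in_Lp_W1p_0 ::
    "'a::euclidean_space set \<Rightarrow> real \<Rightarrow> real \<Rightarrow> ('a \<times> real \<Rightarrow> real) \<Rightarrow> ('a \<times> real \<Rightarrow> 'a) \<Rightarrow> bool" where
  "in_Lp_W1p_0 \<Omega> T p u G \<longleftrightarrow>
     Lp (lebesgue_on (parabolic_domain \<Omega> T)) p u \<and>
     Lp (lebesgue_on (parabolic_domain \<Omega> T)) p G \<and>
     (AE t in lebesgue_on {0<..<T}. W1p_0 \<Omega> p (\<lambda>x. u (x, t)) (\<lambda>x. G (x, t)))"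

definition Linf_L2_norm ::
    "'a::euclidean_space set \<Rightarrow> real \<Rightarrow> ('a \<times> real \<Rightarrow> real) \<Rightarrow> ereal" where
  "Linf_L2_norm \<Omega> T u = esssup (lebesgue_on {0<..<T})
     (\<lambda>t. ereal (Lp_norm (lebesgue_on \<Omega>) 2 (\<lambda>x. u (x, t))))"

definition in_Linf_L2 ::
    "'a::euclidean_space set \<Rightarrow> real \<Rightarrow> ('a \<times> real \<Rightarrow> real) \<Rightarrow> bool" where
  "in_Linf_L2 \<Omega> T u \<longleftrightarrow>
     u \<in> borel_measurable (lebesgue_on (parabolic_domain \<Omega> T)) \<and>
     (AE t in lebesgue_on {0<..<T}. Lp (lebesgue_on \<Omega>) 2 (\<lambda>x. u (x, t))) \<and>
     Linf_L2_norm \<Omega> T u < \<infinity>"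

definition in_Lp_dual ::
    "'a::euclidean_space set \<Rightarrow> real \<Rightarrow> real \<Rightarrow> (real \<Rightarrow> ('a \<Rightarrow> real) \<Rightarrow> real) \<Rightarrow> bool" where
  "in_Lp_dual \<Omega> T p g \<longleftrightarrow>
     (AE t in lebesgue_on {0<..<T}. W1p_0_dual \<Omega> p (g t)) \<and>
     (\<forall>w G. W1p_0 \<Omega> p w G \<longrightarrow> (\<lambda>t. g t w) \<in> borel_measurable (lebesgue_on {0<..<T})) \<and>
     Lp (lebesgue_on {0<..<T}) (conj_exp p) (\<lambda>t. dual_norm \<Omega> p (g t))"

definition weak_time_deriv ::
    "'a::euclidean_space set \<Rightarrow> real \<Rightarrow> ('a \<times> real \<Rightarrow> real) \<Rightarrow> (real \<Rightarrow> ('a \<Rightarrow> real) \<Rightarrow> real) \<Rightarrow> bool"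
  where
  "weak_time_deriv \<Omega> T u g \<longleftrightarrow> (\<forall>\<psi>\<in>Cc_infinity (parabolic_domain \<Omega> T).
     (\<integral>z. u z * time_deriv \<psi> z \<partial>lebesgue_on (parabolic_domain \<Omega> T)) =
     - (\<integral>t. g t (\<lambda>x. \<psi> (x, t)) \<partial>lebesgue_on {0<..<T}))"

text \<open>\<open>W_M \<Omega> T p u G g\<close>: \<open>u\<close> belongs to \<open>W\<^sub>M(\<Omega>\<^sub>T)\<close>, with \<open>\<nabla>u = G\<close> and \<open>\<partial>\<^sub>t u = g\<close>.\<close>

definition W_M ::
    "'a::euclidean_space set \<Rightarrow> real \<Rightarrow> real \<Rightarrow> ('a \<times> real \<Rightarrow> real) \<Rightarrow> ('a \<times> real \<Rightarrow> 'a) \<Rightarrow>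
     (real \<Rightarrow> ('a \<Rightarrow> real) \<Rightarrow> real) \<Rightarrow> bool" where
  "W_M \<Omega> T p u G g \<longleftrightarrow> in_Lp_W1p_0 \<Omega> T p u G \<and> in_Linf_L2 \<Omega> T u \<and>
     in_Lp_dual \<Omega> T p g \<and> weak_time_deriv \<Omega> T u g"

definition W_M_norm ::
    "'a::euclidean_space set \<Rightarrow> real \<Rightarrow> real \<Rightarrow> ('a \<times> real \<Rightarrow> real) \<Rightarrow> ('a \<times> real \<Rightarrow> 'a) \<Rightarrow>
     (real \<Rightarrow> ('a \<Rightarrow> real) \<Rightarrow> real) \<Rightarrow> real" where
  "W_M_norm \<Omega> T p u G g =
     Lp_norm (lebesgue_on (parabolic_domain \<Omega> T)) p G +
     Lp_norm (lebesgue_on {0<..<T}) (conj_exp p) (\<lambda>t. dual_norm \<Omega> p (g t)) +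
     real_of_ereal (Linf_L2_norm \<Omega> T u)"

text \<open>Every \<open>\<phi>\<close> in \<open>test_restrictions \<Omega> T\<close> lies in \<open>W\<^sub>M(\<Omega>\<^sub>T)\<close>, and the norm does not depend on
  which representatives \<open>G\<close>, \<open>g\<close> of its weak derivatives are taken.\<close>

definition in_W_M_dual ::
    "'a::euclidean_space set \<Rightarrow> real \<Rightarrow> real \<Rightarrow> ('a \<times> real) measure \<Rightarrow> bool" where
  "in_W_M_dual \<Omega> T p \<mu> \<longleftrightarrow>
     (\<exists>C. \<forall>\<phi>\<in>test_restrictions \<Omega> T. \<forall>G g. W_M \<Omega> T p \<phi> G g \<longrightarrow>
        \<bar>\<integral>z. \<phi> z \<partial>\<mu>\<bar> \<le> C * W_M_norm \<Omega> T p \<phi> G g)"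

end

theory Submission
  imports Defs "HOL-Computational_Algebra.Polynomial"
begin

text \<open>A point has zero \<open>n\<close>-capacity in \<open>\<real>\<^sup>n\<close> for \<open>n \<ge> 2\<close>: averaging \<open>N\<close> dyadic rescalings of one bump
  centred at \<open>x0\<close> gives test functions \<open>\<eta>\<close> with a fixed positive value at \<open>x0\<close> whose \<open>L\<^sup>2\<close> norm and
  whose gradient's \<open>L\<^sup>n\<close> norm tend to 0, the \<open>n\<close>-th power of the latter being of order \<open>N / N\<^sup>n\<close>.
  Test functions on \<open>\<Omega>\<^sub>T\<close> need not vanish at the times \<open>0\<close> and \<open>T\<close>, so \<open>\<eta>(x) \<theta>(t)\<close> with \<open>\<theta> = 1\<close> on
  \<open>[0, T]\<close> is admissible and has time derivative 0. Its integral against \<open>\<mu>\<close> is \<open>\<eta>(x0) |J|\<close>, which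
  stays bounded away from 0 although the norm in \<open>W\<^sub>M\<close> tends to 0.\<close>

section \<open>Smooth functions\<close>

text \<open>The exponent p = n is critical: shrinking one bump leaves the L^n norm of its gradient
  unchanged, so no single scale works, and the height at \<open>x0\<close> has to be spread over
  many scales. The gain 1/N^n from averaging must survive the summation; dyadic radii ensure this,
  because the gradient bounds active at a point then form a geometric progression.
  \<open>in_W_M_dual\<close> ranges over all representatives of the weak derivatives, so refuting it
  takes just one pair per test function, and the zero functional serves as time derivative.
  Integration by parts is therefore needed for smooth functions only. \<open>Ck\<close> recurs
  through directional derivatives. Smoothness of exp(-1/s) and of reciprocals is reduced to families
  of functions that are closed under differentiation. The growth bound has nothing to do with
  capacity: n + q - p = q, and a cylinder of time length 2 r^q meets the line in a set of at most
  that length.\<close>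

lemma Ck_imp_continuous: "Ck k f \<Longrightarrow> continuous_on UNIV f"
  by (cases k) (auto simp: continuous_on_eq_continuous_at intro: differentiable_imp_continuous_within)

text \<open>\<open>Ck (Suc k)\<close> speaks only about derivatives, so monotonicity in the order
  needs its own induction. The product rule relies on it, since \<open>f\<close> and
  \<open>g\<close> themselves recur in the derivative of the product.\<close>

lemma Ck_SucD: "Ck (Suc k) f \<Longrightarrow> Ck k f"
proof (induction k arbitrary: f)
  case 0
  then show ?case using Ck_imp_continuous[OF 0] by simp
next
  case (Suc k)
  show ?case
    unfolding Ck.simps(2)[of k f]
  proof (intro conjI allI)
    show "f differentiable at x" for x using Suc.prems by simp
    show "Ck k (\<lambda>x. frechet_derivative f (at x) v)" for v
      using Suc.prems Suc.IH by simp
  qed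
qed

text \<open>By uniqueness of the derivative any explicit formula may replace the choice made by
  \<open>frechet_derivative\<close>.\<close>

lemma Ck_SucI:
  assumes "\<And>x. (f has_derivative f' x) (at x)" and "\<And>v. Ck k (\<lambda>x. f' x v)"
  shows "Ck (Suc k) f"
proof -
  have "frechet_derivative f (at x) = f' x" for x
    using frechet_derivative_at[OF assms(1)] by simp
  then show ?thesis
    using assms by (auto simp: differentiable_def)
qed

lemma Ck_derivative:
  assumes "Ck (Suc k) f"
  shows "(f has_derivative frechet_derivative f (at x)) (at x)"
  using assms frechet_derivative_works by auto

lemma Ck_const: "Ck k (\<lambda>x. c)"
proof (induction k arbitrary: c)
  case (Suc k)
  show ?case by (rule Ck_SucI[where f' = "\<lambda>x v. 0"]) (use Suc in auto)
qed simp

lemma Ck_bounded_linear: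
  assumes "bounded_linear f"
  shows "Ck k f"
proof (cases k)
  case 0
  then show ?thesis using assms by (simp add: linear_continuous_on)
next
  case (Suc m)
  show ?thesis unfolding Suc
    by (rule Ck_SucI[where f' = "\<lambda>x. f"])
       (use assms in \<open>auto simp: Ck_const intro: bounded_linear_imp_has_derivative\<close>)
qed

lemma Ck_add: "Ck k f \<Longrightarrow> Ck k g \<Longrightarrow> Ck k (\<lambda>x. f x + g x)"
proof (induction k arbitrary: f g)
  case 0
  then show ?case by (auto intro: continuous_intros)
next
  case (Suc k)
  show ?case
    by (rule Ck_SucI[OF has_derivative_add[OF Ck_derivative[OF Suc.prems(1)] Ck_derivative[OF Suc.prems(2)]]])
       (use Suc in auto)
qed

lemma Ck_mult: "Ck k f \<Longrightarrow> Ck k g \<Longrightarrow> Ck k (\<lambda>x. f x * g x)"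
proof (induction k arbitrary: f g)
  case 0
  then show ?case by (auto intro: continuous_intros)
next
  case (Suc k)
  show ?case
    by (rule Ck_SucI[OF has_derivative_mult[OF Ck_derivative[OF Suc.prems(1)] Ck_derivative[OF Suc.prems(2)]]],
        rule Ck_add; rule Suc.IH)
       (use Suc.prems Ck_SucD[OF Suc.prems(1)] Ck_SucD[OF Suc.prems(2)] in auto)
qed

lemma Ck_diff: "Ck k f \<Longrightarrow> Ck k g \<Longrightarrow> Ck k (\<lambda>x. f x - g x)"
  using Ck_add[of k f "\<lambda>x. (-1) * g x"] Ck_mult[OF Ck_const[of k "-1"], of g] by simp

lemma Ck_sum: "(\<And>i. i \<in> I \<Longrightarrow> Ck k (f i)) \<Longrightarrow> Ck k (\<lambda>x. \<Sum>i\<in>I. f i x)"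
  by (induction I rule: infinite_finite_induct) (auto intro: Ck_const Ck_add)

lemma Ck_dist_square: "Ck k (\<lambda>x::'a::euclidean_space. (x - a) \<bullet> (x - a))"
proof -
  have "Ck k (\<lambda>x::'a. x \<bullet> b)" for b
    by (rule Ck_bounded_linear) (rule bounded_linear_inner_left)
  then have "Ck k (\<lambda>x::'a. \<Sum>b\<in>Basis. (x \<bullet> b - a \<bullet> b) * (x \<bullet> b - a \<bullet> b))"
    by (intro Ck_sum Ck_mult Ck_diff Ck_const)
  then show ?thesis by (subst euclidean_inner) (simp add: inner_diff_left)
qed

text \<open>The derivative of \<open>F m\<close> after \<open>h\<close> is \<open>F (Suc m)\<close>
  after \<open>h\<close> times a derivative of \<open>h\<close>, so the whole family closes under
  induction on \<open>k\<close> with \<open>m\<close> arbitrary, and no formula for higher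
  derivatives of a composition is required. The set \<open>S\<close> admits functions such as 1/y
  that are smooth only on part of the line.\<close>

lemma Ck_compose:
  fixes F :: "nat \<Rightarrow> real \<Rightarrow> real" and h :: "'a::euclidean_space \<Rightarrow> real"
  assumes F: "\<And>m y. y \<in> S \<Longrightarrow> (F m has_field_derivative F (Suc m) y) (at y)"
    and h: "\<And>k. Ck k h" "\<And>x. h x \<in> S"
  shows "Ck k (\<lambda>x. F m (h x))"
proof (induction k arbitrary: m)
  case 0
  have "isCont (F m) (h x)" for x
    using F h(2) DERIV_isCont by blast
  moreover have "isCont h x" for x
    using h(1)[of 0] by (simp add: continuous_on_eq_continuous_at)
  ultimately show ?case
    by (auto simp: continuous_on_eq_continuous_at intro: isCont_o2)
next
  case (Suc k)
  have "((\<lambda>x. F m (h x)) has_derivative (\<lambda>v. frechet_derivative h (at x) v * F (Suc m) (h x))) (at x)" for x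
    using has_derivative_compose[OF Ck_derivative[OF h(1)[of "Suc 0"], of x]
        F[of "h x" m, OF h(2), unfolded has_field_derivative_def]]
    by (simp add: mult.commute)
  moreover have "Ck k (\<lambda>x. frechet_derivative h (at x) v * F (Suc m) (h x))" for v
    using h(1)[of "Suc k"] Suc.IH by (intro Ck_mult) auto
  ultimately show ?case by (rule Ck_SucI)
qed

text \<open>Used with \<open>fst\<close> and \<open>snd\<close> to lift functions of x or of t to
  space-time. The direction \<open>L v\<close> does not depend on the point, so each directional
  derivative is again a function composed with \<open>L\<close>.\<close>

lemma Ck_compose_linear:
  assumes L: "bounded_linear L"
  shows "Ck k f \<Longrightarrow> Ck k (\<lambda>x. f (L x))"
proof (induction k arbitrary: f)
  case 0
  then show ?case
    using linear_continuous_on[OF L] continuous_on_compose2 by fastforce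
next
  case (Suc k)
  have "((\<lambda>x. f (L x)) has_derivative (\<lambda>v. frechet_derivative f (at (L x)) (L v))) (at x)" for x
    using has_derivative_compose[OF bounded_linear_imp_has_derivative[OF L] Ck_derivative[OF Suc.prems]] .
  then show ?case by (rule Ck_SucI) (use Suc in auto)
qed

lemma Ck_inverse:
  assumes "\<And>k. Ck k h" and "\<And>x. h x > 0"
  shows "Ck k (\<lambda>x. inverse (h x))"
proof -
  \<comment> \<open>\<open>F m\<close> is the m-th derivative of 1/y.\<close>
  define F where "F = (\<lambda>(m::nat) y::real. (-1) ^ m * fact m * inverse y ^ Suc m)"
  have "(F m has_field_derivative F (Suc m) y) (at y)" if "y \<in> {0<..}" for m y
  proof -
    have "((\<lambda>y. inverse y ^ Suc m) has_field_derivative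
        (1 + of_nat m) * (- (inverse y ^ Suc (Suc 0)) * inverse y ^ m)) (at y)"
      using that by (intro DERIV_power_Suc DERIV_inverse) auto
    then have "(F m has_field_derivative
        ((-1) ^ m * fact m) * ((1 + of_nat m) * (- (inverse y ^ Suc (Suc 0)) * inverse y ^ m))) (at y)"
      unfolding F_def by (rule DERIV_cmult)
    then show ?thesis
      by (rule DERIV_cong) (simp add: F_def algebra_simps)
  qed
  from Ck_compose[where F = F and m = 0 and h = h and S = "{0<..}", OF this assms(1), of k] assms(2) show ?thesis
    by (simp add: F_def)
qed

section \<open>Test functions, vanishing of derivatives off the support, and gradients\<close>

lemma Cc_infinityI:
  assumes "\<And>k. Ck k \<phi>" and "compact K" and "K \<subseteq> U" and "\<And>x. x \<notin> K \<Longrightarrow> \<phi> x = 0"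
  shows "\<phi> \<in> Cc_infinity U"
proof -
  have *: "closure {x. \<phi> x \<noteq> 0} \<subseteq> K"
    using assms(2,4) by (intro closure_minimal) (auto simp: compact_imp_closed)
  then have "compact (closure {x. \<phi> x \<noteq> 0})"
    using bounded_subset[OF compact_imp_bounded[OF assms(2)]] by (simp add: compact_eq_bounded_closed)
  with * assms(1,3) show ?thesis unfolding Cc_infinity_def by blast
qed

lemma Cc_infinity_support:
  assumes "\<phi> \<in> Cc_infinity U"
  obtains K where "compact K" and "K \<subseteq> U" and "\<And>x. x \<notin> K \<Longrightarrow> \<phi> x = 0"
proof (rule that)
  show "\<phi> x = 0" if "x \<notin> closure {x. \<phi> x \<noteq> 0}" for x
    using that set_mp[OF closure_subset, of x "{x. \<phi> x \<noteq> 0}"] by auto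
qed (use assms in \<open>simp_all add: Cc_infinity_def\<close>)

lemma Cc_infinity_Ck: "\<phi> \<in> Cc_infinity U \<Longrightarrow> Ck k \<phi>"
  by (simp add: Cc_infinity_def)

lemma Cc_infinity_derivative:
  "\<phi> \<in> Cc_infinity U \<Longrightarrow> (\<phi> has_derivative frechet_derivative \<phi> (at x)) (at x)"
  using Ck_derivative[OF Cc_infinity_Ck] .

lemma Cc_infinity_zero: "(\<lambda>x. 0) \<in> Cc_infinity U"
  by (rule Cc_infinityI[where K = "{}"]) (auto simp: Ck_const)

lemma has_derivative_eq_0_off_support:
  fixes f :: "'a::euclidean_space \<Rightarrow> real"
  assumes "(f has_derivative D) (at x)" and "compact K" and "\<And>x. x \<notin> K \<Longrightarrow> f x = 0" and "x \<notin> K"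
  shows "D = (\<lambda>v. 0)"
proof -
  have "((\<lambda>x. 0) has_derivative D) (at x)"
    by (rule has_derivative_transform_within_open[OF assms(1), of "- K"])
       (use assms in \<open>auto simp: compact_imp_closed open_Compl\<close>)
  then show ?thesis
    by (metis has_derivative_const has_derivative_unique)
qed

lemma grad_eqI:
  assumes "(f has_derivative (\<lambda>v. g \<bullet> v)) (at x)"
  shows "grad f x = g"
proof -
  have "frechet_derivative f (at x) = (\<lambda>v. g \<bullet> v)"
    using frechet_derivative_at[OF assms] by (rule sym)
  then show ?thesis by (simp add: grad_def euclidean_representation)
qed

lemma has_derivative_grad:
  assumes "Ck (Suc 0) f"
  shows "(f has_derivative (\<lambda>v. grad f x \<bullet> v)) (at x)"
proof -
  note D = Ck_derivative[OF assms, of x]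
  have "frechet_derivative f (at x) v = grad f x \<bullet> v" for v
  proof -
    have "frechet_derivative f (at x) v = frechet_derivative f (at x) (\<Sum>b\<in>Basis. (v \<bullet> b) *\<^sub>R b)"
      by (simp add: euclidean_representation)
    also have "\<dots> = (\<Sum>b\<in>Basis. (v \<bullet> b) * frechet_derivative f (at x) b)"
      using has_derivative_linear[OF D] by (simp add: linear_sum linear_scale)
    also have "\<dots> = grad f x \<bullet> v"
      by (simp add: grad_def inner_sum_right inner_commute[of _ v] mult.commute)
    finally show ?thesis .
  qed
  then have "frechet_derivative f (at x) = (\<lambda>v. grad f x \<bullet> v)" by (rule ext)
  with D show ?thesis by simp
qed

lemma grad_inner: "b \<in> Basis \<Longrightarrow> grad f x \<bullet> b = frechet_derivative f (at x) b"
  by (simp add: grad_def inner_sum_left_Basis)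

lemma continuous_grad:
  assumes "Ck (Suc 0) f"
  shows "continuous_on UNIV (grad f)"
  unfolding grad_def[abs_def]
  by (intro continuous_on_sum continuous_on_scaleR continuous_on_const) (use assms in simp)

lemma grad_eq_0_off_support:
  assumes "Ck (Suc 0) f" and "compact K" and "\<And>x. x \<notin> K \<Longrightarrow> f x = 0" and "x \<notin> K"
  shows "grad f x = 0"
  using has_derivative_eq_0_off_support[OF Ck_derivative[OF assms(1)] assms(2-4)]
  by (simp add: grad_def)

section \<open>Integration by parts and Sobolev functions\<close>

lemma integrable_compact_support:
  fixes f :: "'a::euclidean_space \<Rightarrow> 'b::euclidean_space"
  assumes "continuous_on UNIV f" and "compact K" and "\<And>x. x \<notin> K \<Longrightarrow> f x = 0"
  shows "integrable lborel f"
proof -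
  have "integrable lborel (\<lambda>x. indicator K x *\<^sub>R f x)"
    using assms by (intro borel_integrable_compact) (auto intro: continuous_on_subset)
  moreover have "(\<lambda>x. indicator K x *\<^sub>R f x) = f"
    using assms(3) by (auto simp: indicator_def)
  ultimately show ?thesis by simp
qed

lemma integral_lborel_translate:
  fixes h :: "'a::euclidean_space \<Rightarrow> real"
  assumes "h \<in> borel_measurable borel"
  shows "(\<integral>x. h (x + a) \<partial>lborel) = (\<integral>x. h x \<partial>lborel)"
proof -
  have "(\<integral>x. h x \<partial>lborel) = (\<integral>x. h x \<partial>distr lborel borel ((+) a))"
    by (simp add: lborel_distr_plus)
  also have "\<dots> = (\<integral>x. h (a + x) \<partial>lborel)"
    using assms by (subst integral_distr) auto
  finally show ?thesis by (simp add: add.commute)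
qed

text \<open>Difference quotients integrate to 0 by translation invariance, and dominated convergence
  passes to the limit. This is the only integration by parts in the proof: it serves the weak
  gradient on space and, in direction \<open>(0, 1)\<close>, the weak time derivative on
  space-time.\<close>

lemma integral_directional_derivative_eq_0:
  fixes h :: "'a::euclidean_space \<Rightarrow> real"
  assumes D: "\<And>x. (h has_derivative D x) (at x)" and cont: "continuous_on UNIV (\<lambda>x. D x v)"
    and K: "compact K" "\<And>x. x \<notin> K \<Longrightarrow> h x = 0"
  shows "(\<integral>x. D x v \<partial>lborel) = 0"
proof -
  have hc: "continuous_on UNIV h"
    using has_derivative_continuous[OF D] by (simp add: continuous_on_eq_continuous_at)
  have D0: "D x v = 0" if "x \<notin> K" for x
    using has_derivative_eq_0_off_support[OF D K that] by simp
  obtain B where B: "B > 0" "\<And>x. x \<in> K \<Longrightarrow> \<bar>D x v\<bar> \<le> B"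
    using compact_imp_bounded[OF compact_continuous_image[OF continuous_on_subset[OF cont] K(1)]]
    by (auto simp: bounded_pos)
  obtain r where r: "K \<subseteq> cball 0 r"
    using compact_imp_bounded[OF K(1)] unfolding bounded_iff by (auto simp: subset_iff)
  \<comment> \<open>Steps of length at most 1 keep the supports of all quotients in one ball, of
    radius \<open>r + norm v\<close>.\<close>
  define s where "s n = 1 / real (Suc n)" for n
  have s: "0 < s n" "s n \<le> 1" for n by (auto simp: s_def)
  define q where "q n x = (h (x + s n *\<^sub>R v) - h x) / s n" for n x
  have deriv: "((\<lambda>t. h (x + t *\<^sub>R v)) has_field_derivative D (x + t *\<^sub>R v) v) (at t)" for x t
  proof -
    have "((\<lambda>t. x + t *\<^sub>R v) has_derivative (\<lambda>t. t *\<^sub>R v)) (at t)"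
      by (auto intro!: derivative_eq_intros)
    from has_derivative_compose[OF this D]
    have "((\<lambda>t. h (x + t *\<^sub>R v)) has_derivative (\<lambda>u. D (x + t *\<^sub>R v) (u *\<^sub>R v))) (at t)" .
    moreover have "D (x + t *\<^sub>R v) (u *\<^sub>R v) = D (x + t *\<^sub>R v) v * u" for u
      using linear_cmul[OF has_derivative_linear[OF D]] by simp
    ultimately show ?thesis by (simp add: has_field_derivative_def)
  qed
  have int: "integrable lborel h" by (rule integrable_compact_support[OF hc K])
  have hm: "h \<in> borel_measurable borel" using hc by (rule borel_measurable_continuous_onI)
  have q0: "(\<integral>x. q n x \<partial>lborel) = 0" for n
  proof -
    have "integrable (distr lborel borel ((+) (s n *\<^sub>R v))) h" using int by (simp add: lborel_distr_plus)
    then have "integrable lborel (\<lambda>x. h (x + s n *\<^sub>R v))"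
      by (subst (asm) integrable_distr_eq) (use hm in \<open>auto simp: add.commute\<close>)
    then have "(\<integral>x. h (x + s n *\<^sub>R v) - h x \<partial>lborel) = 0"
      using int integral_lborel_translate[OF hm] by simp
    then show ?thesis unfolding q_def by simp
  qed
  have "(\<lambda>n. \<integral>x. q n x \<partial>lborel) \<longlonglongrightarrow> (\<integral>x. D x v \<partial>lborel)"
  proof (rule integral_dominated_convergence[where w = "\<lambda>x. B * indicator (cball 0 (r + norm v)) x"])
    show "(\<lambda>x. D x v) \<in> borel_measurable lborel"
      using cont by (simp add: borel_measurable_continuous_onI)
    show "q n \<in> borel_measurable lborel" for n
      unfolding q_def using hm by measurable
    have "emeasure lborel (cball (0::'a) (r + norm v)) < \<infinity>"
      by (rule emeasure_lborel_cball_finite)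
    then show "integrable lborel (\<lambda>x. B * indicator (cball (0::'a) (r + norm v)) x)"
      by (intro integrable_mult_right integrable_real_indicator) auto
    have "(\<lambda>n. q n x) \<longlonglongrightarrow> D x v" for x
    proof -
      have "(\<lambda>u. (h (x + u *\<^sub>R v) - h x) / u) \<midarrow>0\<rightarrow> D x v"
        using deriv[of x 0] by (simp add: DERIV_def)
      moreover have "filterlim s (at 0) sequentially"
        using LIMSEQ_inverse_real_of_nat s
        by (auto simp: filterlim_at s_def[abs_def] inverse_eq_divide)
      ultimately show ?thesis
        unfolding q_def by (rule filterlim_compose)
    qed
    then show "AE x in lborel. (\<lambda>n. q n x) \<longlonglongrightarrow> D x v" by simp
    \<comment> \<open>By the mean value theorem the quotient equals the derivative at a point within
      distance \<open>norm v\<close> of \<open>x\<close>. It vanishes unless that point lies in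
      \<open>K\<close>, which forces \<open>x\<close> into the larger ball.\<close>
    have "norm (q n x) \<le> B * indicator (cball 0 (r + norm v)) x" for n x
    proof -
      obtain u where u: "0 < u" "u < s n"
        "h (x + s n *\<^sub>R v) - h (x + 0 *\<^sub>R v) = (s n - 0) * D (x + u *\<^sub>R v) v"
        using MVT2[OF s(1)[of n], of "\<lambda>t. h (x + t *\<^sub>R v)" "\<lambda>t. D (x + t *\<^sub>R v) v"] deriv by auto
      have q: "q n x = D (x + u *\<^sub>R v) v"
        using u(3) s(1)[of n] by (simp add: q_def)
      show ?thesis
      proof (cases "x + u *\<^sub>R v \<in> K")
        case True
        have "norm (u *\<^sub>R v) \<le> norm v"
          using u(1,2) s(2)[of n] by (simp add: mult_left_le_one_le)
        moreover have "norm x \<le> norm (x + u *\<^sub>R v) + norm (u *\<^sub>R v)"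
          using norm_triangle_ineq4[of "x + u *\<^sub>R v" "u *\<^sub>R v"] by simp
        moreover have "norm (x + u *\<^sub>R v) \<le> r"
          using True r by auto
        ultimately have "norm x \<le> r + norm v" by linarith
        then show ?thesis using B(2)[OF True] q by (simp add: indicator_def)
      next
        case False
        then show ?thesis using D0 q B(1) by (simp add: indicator_def)
      qed
    qed
    then show "AE x in lborel. norm (q n x) \<le> B * indicator (cball 0 (r + norm v)) x" for n by simp
  qed
  then show ?thesis unfolding q0 by (simp add: LIMSEQ_const_iff)
qed

text \<open>The function spaces are built on \<open>lebesgue_on\<close>, while translation
  invariance and product formulas are used for \<open>lborel\<close>. For Borel functions completing
  the measure does not change the integral.\<close>

lemma integral_lebesgue_on_eq_lborel:
  fixes f :: "'a::euclidean_space \<Rightarrow> 'b::euclidean_space"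
  assumes "f \<in> borel_measurable borel" and "S \<in> sets borel" and "\<And>x. x \<notin> S \<Longrightarrow> f x = 0"
  shows "(\<integral>x. f x \<partial>lebesgue_on S) = (\<integral>x. f x \<partial>lborel)"
proof -
  have "(\<integral>x. f x \<partial>lebesgue_on S) = (\<integral>x. indicator S x *\<^sub>R f x \<partial>lebesgue)"
    using assms(2) by (intro integral_restrict_space) (auto simp: sets_completionI_sets)
  also have "(\<lambda>x. indicator S x *\<^sub>R f x) = f"
    using assms(3) by (auto simp: indicator_def)
  finally show ?thesis using assms(1) by (simp add: integral_completion)
qed

lemma integrable_lebesgue_on:
  fixes f :: "'a::euclidean_space \<Rightarrow> 'b::euclidean_space"
  assumes "integrable lborel f" and "S \<in> sets borel"
  shows "integrable (lebesgue_on S) f"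
proof -
  have "integrable lborel (\<lambda>x. indicator S x *\<^sub>R f x)"
    using assms by (intro integrable_mult_indicator) auto
  then show ?thesis
    using assms(2) by (subst integrable_restrict_space) (auto simp: sets_completionI_sets integrable_completion)
qed

lemma borel_measurable_lebesgue_on:
  fixes f :: "'a::euclidean_space \<Rightarrow> 'b::euclidean_space"
  assumes "f \<in> borel_measurable borel"
  shows "f \<in> borel_measurable (lebesgue_on S)"
  using assms by (simp add: measurable_completion measurable_restrict_space1)

section \<open>Test functions as elements of L^p and W_0^{1,p}\<close>

lemma Lp_compact_support:
  fixes f :: "'a::euclidean_space \<Rightarrow> 'b::euclidean_space"
  assumes f: "continuous_on UNIV f" "compact K" "\<And>x. x \<notin> K \<Longrightarrow> f x = 0"
    and "S \<in> sets borel" and "p > 0"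
  shows "Lp (lebesgue_on S) p f"
proof -
  have "continuous_on UNIV (\<lambda>x. norm (f x) powr p)"
    using f(1) \<open>p > 0\<close> by (intro continuous_on_powr' continuous_intros) auto
  then have "integrable lborel (\<lambda>x. norm (f x) powr p)"
    by (rule integrable_compact_support[OF _ f(2)]) (use f(3) in auto)
  then show ?thesis
    using assms unfolding Lp_def
    by (auto intro!: integrable_lebesgue_on borel_measurable_lebesgue_on borel_measurable_continuous_onI)
qed

lemma Lp_cong: "(\<And>x. x \<in> S \<Longrightarrow> f x = g x) \<Longrightarrow> Lp (lebesgue_on S) p f = Lp (lebesgue_on S) p g"
  unfolding Lp_def
  by (intro conj_cong measurable_cong Bochner_Integration.integrable_cong) auto

lemma Lp_norm_cong:
  "(\<And>x. x \<in> S \<Longrightarrow> f x = g x) \<Longrightarrow> Lp_norm (lebesgue_on S) p f = Lp_norm (lebesgue_on S) p g"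
  unfolding Lp_norm_def
  by (intro arg_cong[where f = "\<lambda>x. x powr _"] Bochner_Integration.integral_cong) auto

text \<open>Elements of \<open>test_restrictions\<close> are \<open>undefined\<close> off the
  domain, so their time slices can be compared with a test function only on \<Omega>.\<close>

lemma W1p_0_cong:
  assumes "\<And>x. x \<in> \<Omega> \<Longrightarrow> w x = w' x"
  shows "W1p_0 \<Omega> p w G \<longleftrightarrow> W1p_0 \<Omega> p w' G"
proof -
  have "weak_gradient \<Omega> w G \<longleftrightarrow> weak_gradient \<Omega> w' G"
    unfolding weak_gradient_def
    by (intro ball_cong arg_cong2[where f = "(=)"] Bochner_Integration.integral_cong) (use assms in auto)
  moreover have "Lp_norm (lebesgue_on \<Omega>) p (\<lambda>x. \<phi> x - w x) = Lp_norm (lebesgue_on \<Omega>) p (\<lambda>x. \<phi> x - w' x)" for \<phi>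
    using assms by (intro Lp_norm_cong) auto
  ultimately show ?thesis
    using Lp_cong[of \<Omega> w w' p, OF assms] by (simp add: W1p_0_def W1p_def)
qed

text \<open>The product rule for \<eta> \<psi>, integrated one coordinate at a time: every
  directional derivative \<open>D x b\<close> of the product has integral 0.\<close>

lemma weak_gradient_test_function:
  fixes \<eta> :: "'a::euclidean_space \<Rightarrow> real"
  assumes "open \<Omega>" and \<eta>: "\<eta> \<in> Cc_infinity \<Omega>"
  shows "weak_gradient \<Omega> \<eta> (grad \<eta>)"
  unfolding weak_gradient_def
proof
  fix \<psi> assume \<psi>: "\<psi> \<in> Cc_infinity \<Omega>"
  obtain K where K: "compact K" "K \<subseteq> \<Omega>" "\<And>x. x \<notin> K \<Longrightarrow> \<eta> x = 0"
    using Cc_infinity_support[OF \<eta>] by blast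
  note gK = grad_eq_0_off_support[OF Cc_infinity_Ck[OF \<eta>] K(1,3)]
  have c: "continuous_on UNIV \<eta>" "continuous_on UNIV \<psi>"
    using Cc_infinity_Ck[OF \<eta>, of 0] Cc_infinity_Ck[OF \<psi>, of 0] by auto
  have c1: "continuous_on UNIV (\<lambda>x. \<eta> x *\<^sub>R grad \<psi> x)" and c2: "continuous_on UNIV (\<lambda>x. \<psi> x *\<^sub>R grad \<eta> x)"
    using c continuous_grad[OF Cc_infinity_Ck[OF \<eta>]] continuous_grad[OF Cc_infinity_Ck[OF \<psi>]]
    by (auto intro!: continuous_intros)
  define D where "D x v = \<eta> x * frechet_derivative \<psi> (at x) v + frechet_derivative \<eta> (at x) v * \<psi> x" for x v
  have Db: "(\<integral>x. D x b \<partial>lborel) = 0" for b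
  proof (rule integral_directional_derivative_eq_0[where h = "\<lambda>x. \<eta> x * \<psi> x", OF _ _ K(1)])
    show "((\<lambda>x. \<eta> x * \<psi> x) has_derivative D x) (at x)" for x
      unfolding D_def using has_derivative_mult[OF Cc_infinity_derivative[OF \<eta>] Cc_infinity_derivative[OF \<psi>]] .
    show "continuous_on UNIV (\<lambda>x. D x b)"
      unfolding D_def using c Cc_infinity_Ck[OF \<eta>, of "Suc 0"] Cc_infinity_Ck[OF \<psi>, of "Suc 0"]
      by (auto intro!: continuous_intros)
  qed (use K in auto)
  have i1: "integrable lborel (\<lambda>x. \<eta> x *\<^sub>R grad \<psi> x)" and i2: "integrable lborel (\<lambda>x. \<psi> x *\<^sub>R grad \<eta> x)"
    using integrable_compact_support[OF c1 K(1)] integrable_compact_support[OF c2 K(1)] K(3) gK by auto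
  have "(\<integral>x. \<eta> x *\<^sub>R grad \<psi> x \<partial>lborel) + (\<integral>x. \<psi> x *\<^sub>R grad \<eta> x \<partial>lborel) =
      (\<integral>x. \<eta> x *\<^sub>R grad \<psi> x + \<psi> x *\<^sub>R grad \<eta> x \<partial>lborel)"
    using i1 i2 by simp
  also have "\<dots> = 0"
  proof (rule euclidean_eqI)
    fix b :: 'a assume b: "b \<in> Basis"
    have "(\<integral>x. \<eta> x *\<^sub>R grad \<psi> x + \<psi> x *\<^sub>R grad \<eta> x \<partial>lborel) \<bullet> b =
        (\<integral>x. (\<eta> x *\<^sub>R grad \<psi> x + \<psi> x *\<^sub>R grad \<eta> x) \<bullet> b \<partial>lborel)"
      using i1 i2 by (intro integral_inner_left[symmetric]) auto
    also have "\<dots> = (\<integral>x. D x b \<partial>lborel)"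
      using b by (simp add: D_def inner_add_left grad_inner mult.commute)
    finally show "(\<integral>x. \<eta> x *\<^sub>R grad \<psi> x + \<psi> x *\<^sub>R grad \<eta> x \<partial>lborel) \<bullet> b = 0 \<bullet> b"
      using Db by simp
  qed
  finally have "(\<integral>x. \<eta> x *\<^sub>R grad \<psi> x \<partial>lborel) = - (\<integral>x. \<psi> x *\<^sub>R grad \<eta> x \<partial>lborel)"
    by (simp add: eq_neg_iff_add_eq_0)
  moreover have "(\<integral>x. \<eta> x *\<^sub>R grad \<psi> x \<partial>lebesgue_on \<Omega>) = (\<integral>x. \<eta> x *\<^sub>R grad \<psi> x \<partial>lborel)"
    using K assms(1) by (intro integral_lebesgue_on_eq_lborel borel_measurable_continuous_onI c1) auto
  moreover have "(\<integral>x. \<psi> x *\<^sub>R grad \<eta> x \<partial>lebesgue_on \<Omega>) = (\<integral>x. \<psi> x *\<^sub>R grad \<eta> x \<partial>lborel)"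
    using K(2) assms(1) gK by (intro integral_lebesgue_on_eq_lborel borel_measurable_continuous_onI c2) auto
  ultimately show "(\<integral>x. \<eta> x *\<^sub>R grad \<psi> x \<partial>lebesgue_on \<Omega>) = - (\<integral>x. \<psi> x *\<^sub>R grad \<eta> x \<partial>lebesgue_on \<Omega>)"
    by simp
qed

lemma W1p_0_test_function:
  fixes \<eta> :: "'a::euclidean_space \<Rightarrow> real"
  assumes "open \<Omega>" and "p > 0" and \<eta>: "\<eta> \<in> Cc_infinity \<Omega>"
  shows "W1p_0 \<Omega> p \<eta> (grad \<eta>)"
proof -
  obtain K where K: "compact K" "K \<subseteq> \<Omega>" "\<And>x. x \<notin> K \<Longrightarrow> \<eta> x = 0"
    using Cc_infinity_support[OF \<eta>] by blast
  note gK = grad_eq_0_off_support[OF Cc_infinity_Ck[OF \<eta>] K(1,3)]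
  have "Lp (lebesgue_on \<Omega>) p \<eta>" "Lp (lebesgue_on \<Omega>) p (grad \<eta>)"
    using Lp_compact_support[OF _ K(1,3)] Lp_compact_support[OF _ K(1) gK] assms
      Cc_infinity_Ck[OF \<eta>, of 0] continuous_grad[OF Cc_infinity_Ck[OF \<eta>]] by auto
  then have "W1p \<Omega> p \<eta> (grad \<eta>)"
    using weak_gradient_test_function[OF assms(1) \<eta>] by (simp add: W1p_def)
  \<comment> \<open>The constant sequence \<eta> is the approximating sequence.\<close>
  moreover have "Lp_norm (lebesgue_on \<Omega>) p (\<lambda>x. \<eta> x - \<eta> x) = 0"
    "Lp_norm (lebesgue_on \<Omega>) p (\<lambda>x. grad \<eta> x - grad \<eta> x) = 0"
    by (auto simp: Lp_norm_def)
  ultimately show ?thesis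
    unfolding W1p_0_def using \<eta> by (intro conjI exI[of _ "\<lambda>k. \<eta>"]) auto
qed

section \<open>Smooth bumps\<close>

text \<open>The classical function exp(-1/s), extended by 0, with a polynomial factor in 1/s. The
  factor is there to make the family closed under differentiation.\<close>

definition flat :: "real poly \<Rightarrow> real \<Rightarrow> real" where
  "flat P s = (if s \<le> 0 then 0 else exp (- (1 / s)) * poly P (1 / s))"

lemma tendsto_poly_mult_exp_0: "((\<lambda>y::real. exp (- y) * poly P y) \<longlongrightarrow> 0) at_top"
proof -
  have "((\<lambda>y::real. \<Sum>i\<le>degree P. coeff P i * (y ^ i / exp y)) \<longlongrightarrow> (\<Sum>i\<le>degree P. coeff P i * 0)) at_top"
    by (intro tendsto_sum tendsto_mult tendsto_const tendsto_power_div_exp_0)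
  then show ?thesis
    by (simp add: poly_altdef sum_distrib_left exp_minus field_simps)
qed

lemma flat_tendsto_0: "flat P \<midarrow>0\<rightarrow> 0"
proof -
  have "((\<lambda>s. exp (- inverse s) * poly P (inverse s)) \<longlongrightarrow> 0) (at_right 0)"
    by (rule filterlim_compose[OF tendsto_poly_mult_exp_0 filterlim_inverse_at_top_right])
  then have "(flat P \<longlongrightarrow> 0) (at_right 0)"
    by (rule Lim_transform_eventually)
       (auto simp: flat_def eventually_at_filter inverse_eq_divide)
  moreover have "(flat P \<longlongrightarrow> 0) (at_left 0)"
    by (rule Lim_transform_eventually[OF tendsto_const])
       (auto simp: flat_def eventually_at_filter)
  ultimately show ?thesis by (simp add: filterlim_at_split)
qed

text \<open>For s > 0 the derivative of exp(-1/s) P(1/s) is exp(-1/s) (P - P')(1/s) / s^2, and each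
  \<open>pCons 0\<close> contributes one factor 1/s.\<close>

lemma DERIV_flat: "(flat P has_field_derivative flat (pCons 0 (pCons 0 (P - pderiv P))) s) (at s)"
proof (cases s "0::real" rule: linorder_cases)
  case less
  have "((\<lambda>x. 0) has_field_derivative 0) (at s)" by simp
  then have "(flat P has_field_derivative 0) (at s)"
    by (rule DERIV_cong_ev[THEN iffD1, rotated -1])
       (use less eventually_nhds_in_open[of "{..<0}" s] in \<open>auto simp: flat_def elim!: eventually_mono\<close>)
  then show ?thesis using less by (simp add: flat_def)
next
  case equal
  \<comment> \<open>At 0 the difference quotient is itself a member of the family, so its limit is
    already known.\<close>
  have "(\<lambda>h. flat P h / h) = flat (pCons 0 P)"
    by (auto simp: flat_def)
  then show ?thesis
    using flat_tendsto_0[of "pCons 0 P"] by (simp add: equal DERIV_def flat_def[of _ 0])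
next
  case greater
  have "((\<lambda>x. exp (- (1 / x)) * poly P (1 / x)) has_field_derivative
      exp (- (1 / s)) * (1 / s\<^sup>2) * poly P (1 / s) +
      exp (- (1 / s)) * (poly (pderiv P) (1 / s) * (- 1 / s\<^sup>2))) (at s)"
    using greater by (auto intro!: derivative_eq_intros DERIV_chain2[OF poly_DERIV] simp: power2_eq_square)
  then have "(flat P has_field_derivative
      exp (- (1 / s)) * (1 / s\<^sup>2) * poly P (1 / s) +
      exp (- (1 / s)) * (poly (pderiv P) (1 / s) * (- 1 / s\<^sup>2))) (at s)"
    by (rule DERIV_cong_ev[THEN iffD1, rotated -1])
       (use greater eventually_nhds_in_open[of "{0<..}" s] in \<open>auto simp: flat_def elim!: eventually_mono\<close>)
  then show ?thesis
    by (rule DERIV_cong) (use greater in \<open>simp add: flat_def field_simps power2_eq_square\<close>)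
qed

lemma Ck_flat:
  assumes "\<And>k. Ck k h"
  shows "Ck k (\<lambda>x. flat 1 (h x))"
proof -
  define F where "F = (\<lambda>m. flat (((\<lambda>P. pCons 0 (pCons 0 (P - pderiv P))) ^^ m) 1))"
  have "(F m has_field_derivative F (Suc m) y) (at y)" if "y \<in> UNIV" for m y
    unfolding F_def using DERIV_flat by simp
  from Ck_compose[where F = F and m = 0 and S = UNIV and h = h, OF this assms] show ?thesis
    by (simp add: F_def)
qed

lemma flat_1_bounds: "0 \<le> flat 1 s" "flat 1 s \<le> 1"
  by (auto simp: flat_def)

text \<open>\<open>flat [:0, 0, 1:]\<close> is the derivative of \<open>flat 1\<close>. With y = 1/s
  the bound is y^2 exp(-y) \<le> 2, which follows from exp y \<ge> y^2 / 2.\<close>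

lemma flat_square_bounds: "\<bar>flat [:0, 0, 1:] s\<bar> \<le> 2"
proof (cases "s \<le> 0")
  case False
  define y where "y = 1 / s"
  have "y > 0" using False by (simp add: y_def)
  then have "y\<^sup>2 / 2 \<le> exp y"
    using exp_lower_Taylor_quadratic[of y] by linarith
  then have "exp (- y) * (y * y) \<le> 2"
    by (simp add: exp_minus field_simps power2_eq_square)
  moreover have "0 \<le> exp (- y) * (y * y)" by simp
  ultimately show ?thesis using False by (simp add: flat_def y_def)
qed (simp add: flat_def)

text \<open>The parameter \<open>c\<close> is the reciprocal of the radius. The squared distance is
  used because, unlike the norm, it is smooth at the centre.\<close>

definition bump :: "'a::euclidean_space \<Rightarrow> real \<Rightarrow> 'a \<Rightarrow> real" where
  "bump a c x = flat 1 (1 - c\<^sup>2 * ((x - a) \<bullet> (x - a)))"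

lemma Ck_bump: "Ck k (bump a c)"
  unfolding bump_def[abs_def]
  by (intro Ck_flat Ck_diff Ck_mult Ck_const Ck_dist_square)

lemma bump_center: "bump a c a = exp (- 1)"
  by (simp add: bump_def flat_def)

lemma one_minus_dist_le_0:
  assumes "c > 0" and "x \<notin> ball a (1 / c)"
  shows "1 - c\<^sup>2 * ((x - a) \<bullet> (x - a)) \<le> 0"
proof -
  have "1 \<le> c * norm (x - a)"
    using assms by (simp add: dist_norm norm_minus_commute field_simps)
  then have "1\<^sup>2 \<le> (c * norm (x - a))\<^sup>2" by (intro power_mono) auto
  then show ?thesis by (simp add: power_mult_distrib power2_norm_eq_inner)
qed

lemma bump_le_indicator:
  assumes "c > 0"
  shows "bump a c x \<le> indicator (ball a (1 / c)) x"
  using one_minus_dist_le_0[OF assms, of x a] flat_1_bounds(2)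
  by (auto simp: bump_def indicator_def flat_def)

lemma bump_nonneg: "0 \<le> bump a c x"
  by (simp add: bump_def flat_1_bounds)

text \<open>By the chain rule the gradient is a multiple of \<open>x - a\<close> with factor -2 c^2
  times the derivative of \<open>flat 1\<close>. On the ball c |x - a| \<le> 1 absorbs one power of
  \<open>c\<close>, and \<open>flat_square_bounds\<close> turns the remaining 2 c into 4 c.\<close>

lemma norm_grad_bump_le:
  assumes "c > 0"
  shows "norm (grad (bump a c) x) \<le> 4 * c * indicator (ball a (1 / c)) x"
proof -
  define s where "s = 1 - c\<^sup>2 * ((x - a) \<bullet> (x - a))"
  have "(flat 1 has_field_derivative flat [:0, 0, 1:] s) (at s)"
    using DERIV_flat[of 1 s] by (simp add: one_pCons)
  moreover have "((\<lambda>x. 1 - c\<^sup>2 * ((x - a) \<bullet> (x - a))) has_derivative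
      (\<lambda>v. - (2 * c\<^sup>2 * ((x - a) \<bullet> v)))) (at x)"
    by (auto intro!: derivative_eq_intros simp: inner_commute)
  ultimately have "((\<lambda>x. flat 1 (1 - c\<^sup>2 * ((x - a) \<bullet> (x - a)))) has_derivative
      (\<lambda>v. flat [:0, 0, 1:] s * - (2 * c\<^sup>2 * ((x - a) \<bullet> v)))) (at x)"
    unfolding s_def has_field_derivative_def
    by (rule has_derivative_compose[rotated])
  then have "grad (bump a c) x = (- (2 * c\<^sup>2 * flat [:0, 0, 1:] s)) *\<^sub>R (x - a)"
    by (intro grad_eqI) (simp add: bump_def[abs_def] algebra_simps)
  then have eq: "norm (grad (bump a c) x) = 2 * c\<^sup>2 * \<bar>flat [:0, 0, 1:] s\<bar> * norm (x - a)"
    by (simp add: abs_mult)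
  show ?thesis
  proof (cases "x \<in> ball a (1 / c)")
    case True
    then have *: "c * norm (x - a) \<le> 1"
      using assms by (simp add: dist_norm norm_minus_commute field_simps)
    have "2 * c\<^sup>2 * \<bar>flat [:0, 0, 1:] s\<bar> * norm (x - a) =
        2 * c * (\<bar>flat [:0, 0, 1:] s\<bar> * (c * norm (x - a)))"
      by (simp add: power2_eq_square)
    also have "\<dots> \<le> 2 * c * (2 * 1)"
      using assms flat_square_bounds * by (intro mult_left_mono mult_mono) auto
    finally show ?thesis using True eq by simp
  next
    case False
    then have "flat [:0, 0, 1:] s = 0"
      using one_minus_dist_le_0[OF assms False] by (simp add: flat_def s_def)
    with eq show ?thesis using assms by simp
  qed
qed

text \<open>The gradient of the \<open>k\<close>-th summand has size \<open>2\<^sup>k / R\<close> on a ball of radius \<open>R / 2\<^sup>k\<close>, so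
  its \<open>L\<^sup>n\<close> norm does not depend on \<open>k\<close>, while the different scales barely interact.\<close>

definition multi_bump :: "'a::euclidean_space \<Rightarrow> real \<Rightarrow> nat \<Rightarrow> 'a \<Rightarrow> real" where
  "multi_bump a R N x = (1 / real N) * (\<Sum>k<N. bump a (2 ^ k / R) x)"

lemma Ck_multi_bump: "Ck k (multi_bump a R N)"
  unfolding multi_bump_def[abs_def]
  by (intro Ck_mult Ck_const Ck_sum Ck_bump)

lemma multi_bump_center: "N > 0 \<Longrightarrow> multi_bump a R N a = exp (- 1)"
  by (simp add: multi_bump_def bump_center)

lemma multi_bump_nonneg: "0 \<le> multi_bump a R N x"
  by (simp add: multi_bump_def bump_nonneg sum_nonneg)

lemma multi_bump_le:
  assumes "R > 0"
  shows "multi_bump a R N x \<le> (\<Sum>k<N. (1 / real N) * indicator (ball a (R / 2 ^ k)) x)"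
  unfolding multi_bump_def sum_distrib_left
  using bump_le_indicator[of "2 ^ _ / R" a x] assms
  by (intro sum_mono mult_left_mono) auto

lemma multi_bump_le_1:
  assumes "R > 0"
  shows "multi_bump a R N x \<le> 1"
proof -
  have "multi_bump a R N x \<le> (\<Sum>k<N. (1 / real N) * 1)"
    using multi_bump_le[OF assms, of a N x]
    by (rule order_trans) (intro sum_mono mult_left_mono indicator_le_1, auto)
  also have "\<dots> \<le> 1" by simp
  finally show ?thesis .
qed

lemma multi_bump_eq_0:
  assumes "R > 0" and "x \<notin> ball a R"
  shows "multi_bump a R N x = 0"
proof -
  have "R / 2 ^ k \<le> R" for k
    using assms(1) by (simp add: divide_le_eq mult_le_cancel_left1)
  then have "x \<notin> ball a (R / 2 ^ k)" for k
    using assms(2) by (meson in_mono subset_ball)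
  then show ?thesis
    using multi_bump_le[OF assms(1), of a N x] multi_bump_nonneg[of a R N x] by simp
qed

lemma norm_grad_multi_bump_le:
  assumes "R > 0"
  shows "norm (grad (multi_bump a R N) x) \<le>
    (4 / (real N * R)) * (\<Sum>k<N. 2 ^ k * indicator (ball a (R / 2 ^ k)) x)"
proof -
  have D: "(bump a c has_derivative (\<lambda>v. grad (bump a c) x \<bullet> v)) (at x)" for c
    by (rule has_derivative_grad[OF Ck_bump])
  have "grad (multi_bump a R N) x = (1 / real N) *\<^sub>R (\<Sum>k<N. grad (bump a (2 ^ k / R)) x)"
    unfolding multi_bump_def[abs_def]
    by (rule grad_eqI, rule has_derivative_eq_rhs[OF has_derivative_mult_right[OF has_derivative_sum[OF D]]])
       (simp add: inner_sum_left)
  then have "norm (grad (multi_bump a R N) x) \<le> (1 / real N) * (\<Sum>k<N. norm (grad (bump a (2 ^ k / R)) x))"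
    by (simp add: divide_right_mono norm_sum)
  also have "\<dots> \<le> (1 / real N) * (\<Sum>k<N. 4 * (2 ^ k / R) * indicator (ball a (R / 2 ^ k)) x)"
    using norm_grad_bump_le[of "2 ^ _ / R" a x] assms
    by (intro mult_left_mono sum_mono) auto
  also have "\<dots> = (4 / (real N * R)) * (\<Sum>k<N. 2 ^ k * indicator (ball a (R / 2 ^ k)) x)"
    unfolding sum_distrib_left by (intro sum.cong refl) (simp add: field_simps)
  finally show ?thesis .
qed

text \<open>The last nonzero term of a lacunary sum dominates the whole sum up to a factor 2.\<close>

lemma lacunary_sum_powr_le:
  assumes "p > 0" and "\<And>k. d k = 0 \<or> d k = (1::real)"
  shows "(\<Sum>k<N. 2 ^ k * d k) powr p \<le> (\<Sum>k<N. (2 * 2 ^ k) powr p * d k)"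
proof (induction N)
  case (Suc N)
  have d: "0 \<le> d k" "d k \<le> 1" for k using assms(2)[of k] by auto
  show ?case
  proof (cases "d N = 0")
    case False
    then have dN: "d N = 1" using assms(2) by blast
    have "(\<Sum>k<Suc N. 2 ^ k * d k) \<le> (\<Sum>k<Suc N. 2 ^ k * 1)"
      using d by (intro sum_mono mult_left_mono) auto
    also have "\<dots> \<le> 2 * 2 ^ N"
      by (simp only: mult_1_right) (subst geometric_sum; simp)
    finally have "(\<Sum>k<Suc N. 2 ^ k * d k) powr p \<le> (2 * 2 ^ N) powr p"
      using d assms(1) by (intro powr_mono2 sum_nonneg) auto
    also have "\<dots> \<le> (\<Sum>k<Suc N. (2 * 2 ^ k) powr p * d k)"
      using d dN by (simp add: sum_nonneg)
    finally show ?thesis .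
  qed (use Suc in simp)
qed (use assms in simp)

text \<open>Reduces both norm estimates to pointwise bounds by step functions. If \<open>f\<close>
  fails to be integrable, its Bochner integral is 0 and still lies below the nonnegative
  majorant.\<close>

lemma integral_lebesgue_on_le_sum:
  fixes f :: "'a::euclidean_space \<Rightarrow> real"
  assumes "S \<in> sets borel" and "\<And>x. x \<in> S \<Longrightarrow> f x \<le> (\<Sum>i\<in>I. c i * indicator (A i) x)"
    and c: "\<And>i. i \<in> I \<Longrightarrow> 0 \<le> c i" and A: "\<And>i. i \<in> I \<Longrightarrow> A i \<in> sets borel"
    and fin: "\<And>i. i \<in> I \<Longrightarrow> emeasure lborel (A i) < \<infinity>"
  shows "(\<integral>x. f x \<partial>lebesgue_on S) \<le> (\<Sum>i\<in>I. c i * measure lborel (A i))"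
proof -
  define g where "g x = (\<Sum>i\<in>I. c i * indicator (A i) x)" for x
  have g0: "0 \<le> g x" for x using c by (auto simp: g_def intro!: sum_nonneg)
  have ii: "integrable lborel (\<lambda>x. c i * indicator (A i) x)" if "i \<in> I" for i
    using A[OF that] fin[OF that] by (intro integrable_mult_right integrable_real_indicator) auto
  then have gi: "integrable lborel g"
    unfolding g_def by (intro Bochner_Integration.integrable_sum) auto
  have "(\<integral>x. f x \<partial>lebesgue_on S) \<le> (\<integral>x. g x \<partial>lebesgue_on S)"
    using g0 assms(2) by (intro integral_mono' integrable_lebesgue_on[OF gi assms(1)]) (auto simp: g_def)
  also have "\<dots> = (\<integral>x. indicator S x * g x \<partial>lebesgue_on S)"
    by (intro Bochner_Integration.integral_cong) auto
  also have "\<dots> = (\<integral>x. indicator S x * g x \<partial>lborel)"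
    using assms(1) borel_measurable_integrable[OF gi] by (intro integral_lebesgue_on_eq_lborel) auto
  also have "\<dots> \<le> (\<integral>x. g x \<partial>lborel)"
    using g0 by (intro integral_mono' gi) (auto simp: indicator_def)
  also have "\<dots> = (\<Sum>i\<in>I. c i * measure lborel (A i))"
    unfolding g_def using ii A by (subst Bochner_Integration.integral_sum) auto
  finally show ?thesis .
qed

lemma emeasure_lborel_Times:
  fixes A :: "'a::euclidean_space set" and B :: "'b::euclidean_space set"
  assumes "A \<in> sets borel" and "B \<in> sets borel"
  shows "emeasure lborel (A \<times> B) = emeasure lborel A * emeasure lborel B"
  using assms by (simp add: lborel_prod[symmetric] lborel.emeasure_pair_measure_Times)

text \<open>The 8 is the constant 4 of a single gradient times the factor 2 lost in the lacunary
  sum, and \<open>T\<close> comes from integrating over time.\<close>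

lemma integral_norm_grad_multi_bump_powr_le:
  fixes a :: "'a::euclidean_space"
  assumes "open \<Omega>" and "R > 0" and "T > 0" and "N > 0" and "DIM('a) \<ge> 2"
  shows "(\<integral>z. norm (grad (multi_bump a R N) (fst z)) powr real DIM('a) \<partial>lebesgue_on (parabolic_domain \<Omega> T))
    \<le> 8 ^ DIM('a) * unit_ball_vol (real DIM('a)) * T / real N"
proof -
  let ?n = "DIM('a)" and ?\<omega> = "unit_ball_vol (real DIM('a))"
  define A where "A k = ball a (R / 2 ^ k) \<times> {0<..<T}" for k :: nat
  define c where "c k = (4 / (real N * R)) powr real ?n * (2 * 2 ^ k) powr real ?n" for k :: nat
  have emA: "emeasure lborel (A k) = ennreal (?\<omega> * (R / 2 ^ k) ^ ?n * T)" for k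
    using assms by (simp add: A_def emeasure_lborel_Times emeasure_ball ennreal_mult'' unit_ball_vol_nonneg)
  have mA: "measure lborel (A k) = ?\<omega> * (R / 2 ^ k) ^ ?n * T" for k
    using assms by (simp add: measure_def emA unit_ball_vol_nonneg)
  have "(\<integral>z. norm (grad (multi_bump a R N) (fst z)) powr real ?n \<partial>lebesgue_on (parabolic_domain \<Omega> T))
      \<le> (\<Sum>k<N. c k * measure lborel (A k))"
  proof (rule integral_lebesgue_on_le_sum)
    show "parabolic_domain \<Omega> T \<in> sets borel"
      using assms(1) by (simp add: parabolic_domain_def borel_open open_Times)
    fix z assume z: "z \<in> parabolic_domain \<Omega> T"
    define d where "d k = indicat_real (ball a (R / 2 ^ k)) (fst z)" for k :: nat
    have d: "d k = 0 \<or> d k = 1" for k by (auto simp: d_def indicator_def)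
    have d0: "0 \<le> d k" for k by (simp add: d_def)
    have dA: "indicat_real (A k) z = d k" for k
      using z by (auto simp: d_def A_def parabolic_domain_def indicator_def)
    have "norm (grad (multi_bump a R N) (fst z)) powr real ?n
        \<le> ((4 / (real N * R)) * (\<Sum>k<N. 2 ^ k * d k)) powr real ?n"
      unfolding d_def by (intro powr_mono2 norm_grad_multi_bump_le assms) auto
    also have "\<dots> = (4 / (real N * R)) powr real ?n * (\<Sum>k<N. 2 ^ k * d k) powr real ?n"
      by (rule powr_mult)
    \<comment> \<open>Convexity would turn the power of the sum into a sum of powers at the cost of
      N^(n-1), which eats up all the decay. The lacunary bound costs only 2^n.\<close>
    also have "\<dots> \<le> (4 / (real N * R)) powr real ?n * (\<Sum>k<N. (2 * 2 ^ k) powr real ?n * d k)"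
      by (intro mult_left_mono lacunary_sum_powr_le d) auto
    also have "\<dots> = (\<Sum>k<N. c k * indicat_real (A k) z)"
      by (simp add: c_def dA sum_distrib_left mult.assoc)
    finally show "norm (grad (multi_bump a R N) (fst z)) powr real ?n \<le> (\<Sum>k<N. c k * indicat_real (A k) z)" .
  next
    show "A k \<in> sets borel" for k by (simp add: A_def borel_open open_Times)
    show "emeasure lborel (A k) < \<infinity>" for k unfolding emA by simp
  qed (simp add: c_def)
  \<comment> \<open>The powers of 2^k and of \<open>R\<close> cancel because the exponent equals the
    dimension.\<close>
  also have "\<dots> = (\<Sum>k<N. (8 / real N) ^ ?n * (?\<omega> * T))"
  proof (rule sum.cong)
    fix k
    have "c k * measure lborel (A k) =
        ((4 / (real N * R)) ^ ?n * (2 * 2 ^ k) ^ ?n * (R / 2 ^ k) ^ ?n) * (?\<omega> * T)"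
      using assms by (simp add: c_def mA powr_realpow)
    also have "\<dots> = (4 / (real N * R) * (2 * 2 ^ k) * (R / 2 ^ k)) ^ ?n * (?\<omega> * T)"
      by (simp only: power_mult_distrib)
    also have "4 / (real N * R) * (2 * 2 ^ k) * (R / 2 ^ k) = 8 / real N"
      using assms by (simp add: field_simps)
    finally show "c k * measure lborel (A k) = (8 / real N) ^ ?n * (?\<omega> * T)" .
  qed simp
  also have "\<dots> = 8 ^ ?n * (?\<omega> * T) * (real N / real N ^ ?n)"
    by (simp add: power_divide)
  also have "\<dots> \<le> 8 ^ ?n * (?\<omega> * T) * (1 / real N)"
  proof (intro mult_left_mono)
    \<comment> \<open>Here dimension at least 2 enters: in dimension 1 the quotient N / N^n would
      not decay.\<close>
    have "real N ^ 2 \<le> real N ^ ?n"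
      using assms by (intro power_increasing) auto
    then show "real N / real N ^ ?n \<le> 1 / real N"
      using assms(4) by (simp add: field_simps power2_eq_square)
  qed (use assms in \<open>simp add: unit_ball_vol_nonneg\<close>)
  finally show ?thesis by simp
qed

text \<open>Values in [0, 1] give \<eta>^2 \<le> \<eta>, and \<eta> lies below the average of the
  indicators of the balls. Their volumes are summable in \<open>k\<close>, so the average
  contributes a factor 1/N.\<close>

lemma integral_multi_bump_square_le:
  fixes a :: "'a::euclidean_space"
  assumes "open \<Omega>" and "R > 0"
  shows "(\<integral>x. norm (multi_bump a R N x) powr 2 \<partial>lebesgue_on \<Omega>)
    \<le> 2 * unit_ball_vol (real DIM('a)) * R ^ DIM('a) / real N"
proof -
  let ?n = "DIM('a)" and ?\<omega> = "unit_ball_vol (real DIM('a))"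
  have "(\<integral>x. norm (multi_bump a R N x) powr 2 \<partial>lebesgue_on \<Omega>)
      \<le> (\<Sum>k<N. (1 / real N) * measure lborel (ball a (R / 2 ^ k)))"
  proof (rule integral_lebesgue_on_le_sum)
    fix x
    have "norm (multi_bump a R N x) powr 2 = multi_bump a R N x * multi_bump a R N x"
      using multi_bump_nonneg[of a R N x] by (simp add: powr_numeral power2_eq_square)
    also have "\<dots> \<le> multi_bump a R N x"
      using multi_bump_nonneg[of a R N x] multi_bump_le_1[OF assms(2), of a N x]
      by (simp add: mult_left_le)
    also have "\<dots> \<le> (\<Sum>k<N. (1 / real N) * indicator (ball a (R / 2 ^ k)) x)"
      by (rule multi_bump_le[OF assms(2)])
    finally show "norm (multi_bump a R N x) powr 2 \<le> (\<Sum>k<N. (1 / real N) * indicator (ball a (R / 2 ^ k)) x)" .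
  qed (use assms in \<open>auto simp: emeasure_ball\<close>)
  also have "\<dots> \<le> (\<Sum>k<N. (1 / real N) * (?\<omega> * (R ^ ?n * (1 / 2) ^ k)))"
  proof (intro sum_mono mult_left_mono)
    fix k :: nat
    \<comment> \<open>Lowering the exponent from n to 1 leaves a geometric series with sum at most 2
      in every dimension.\<close>
    have "((1 / 2) ^ k) ^ ?n \<le> ((1 / 2 :: real) ^ k) ^ 1"
      by (intro power_decreasing) (auto simp: power_le_one DIM_positive Suc_leI)
    then have "R ^ ?n * ((1 / 2) ^ k) ^ ?n \<le> R ^ ?n * (1 / 2) ^ k"
      using assms(2) by (intro mult_left_mono) auto
    moreover have "(R / 2 ^ k) ^ ?n = R ^ ?n * ((1 / 2) ^ k) ^ ?n"
      by (simp add: power_divide)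
    ultimately show "measure lborel (ball a (R / 2 ^ k)) \<le> ?\<omega> * (R ^ ?n * (1 / 2) ^ k)"
      using assms(2) by (simp add: content_ball mult_left_mono unit_ball_vol_nonneg)
  qed auto
  also have "\<dots> = (?\<omega> * R ^ ?n / real N) * (\<Sum>k<N. (1 / 2) ^ k)"
    by (simp add: sum_distrib_left mult.assoc)
  also have "\<dots> \<le> (?\<omega> * R ^ ?n / real N) * 2"
  proof (rule mult_left_mono)
    show "(\<Sum>k<N. (1 / 2 :: real) ^ k) \<le> 2"
      by (simp add: geometric_sum)
  qed (use assms in \<open>simp add: unit_ball_vol_nonneg\<close>)
  finally show ?thesis by (simp add: mult_ac)
qed

section \<open>Separable test functions\<close>

text \<open>The quotient f / (f + g), where \<open>f\<close> is positive exactly on (-2, T + 2) and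
  \<open>g\<close> vanishes exactly on [-1, T + 1]. The gap between these intervals keeps the
  denominator positive everywhere.\<close>

lemma exists_smooth_plateau:
  assumes "0 < T"
  obtains \<theta> :: "real \<Rightarrow> real" where "\<And>k. Ck k \<theta>" and "\<And>t. t \<in> {0..T} \<Longrightarrow> \<theta> t = 1"
    and "\<And>t. t \<notin> {- 2..T + 2} \<Longrightarrow> \<theta> t = 0"
proof -
  define f where "f = (\<lambda>t. flat 1 ((t + 2) * (T + 2 - t)))"
  define g where "g = (\<lambda>t. flat 1 (- ((t + 1) * (T + 1 - t))))"
  have id: "Ck k (\<lambda>t::real. t)" for k by (rule Ck_bounded_linear) (rule bounded_linear_ident)
  have f: "Ck k f" for k
    unfolding f_def by (intro Ck_flat Ck_mult Ck_add Ck_diff Ck_const id)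
  have g: "Ck k g" for k
  proof -
    have "Ck k (\<lambda>t. flat 1 (0 - ((t + 1) * (T + 1 - t))))"
      by (intro Ck_flat Ck_mult Ck_add Ck_diff Ck_const id)
    then show ?thesis by (simp add: g_def)
  qed
  have fpos: "0 < f t" if "- 2 < t" "t < T + 2" for t
  proof -
    have "0 < (t + 2) * (T + 2 - t)" using that by (intro mult_pos_pos) auto
    then show ?thesis by (simp add: f_def flat_def)
  qed
  have gpos: "0 < g t" if "t \<le> - 2 \<or> T + 2 \<le> t" for t
  proof -
    have "(t + 1) * (T + 1 - t) < 0"
      using that assms mult_neg_pos[of "t + 1" "T + 1 - t"] mult_pos_neg[of "t + 1" "T + 1 - t"] by linarith
    then show ?thesis by (simp add: g_def flat_def)
  qed
  have pos: "0 < f t + g t" for t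
  proof -
    have "0 \<le> f t" "0 \<le> g t" by (simp_all add: f_def g_def flat_1_bounds)
    then show ?thesis using fpos[of t] gpos[of t] by linarith
  qed
  show ?thesis
  proof (rule that[of "\<lambda>t. f t * inverse (f t + g t)"])
    show "Ck k (\<lambda>t. f t * inverse (f t + g t))" for k
      by (intro Ck_mult Ck_inverse Ck_add f g pos)
    show "f t * inverse (f t + g t) = 1" if "t \<in> {0..T}" for t
    proof -
      have "0 \<le> (t + 1) * (T + 1 - t)" using that by auto
      then have "g t = 0" by (simp add: g_def flat_def)
      then show ?thesis using pos[of t] by simp
    qed
    show "f t * inverse (f t + g t) = 0" if "t \<notin> {- 2..T + 2}" for t
    proof -
      have "(t + 2) * (T + 2 - t) \<le> 0"
        using that assms by (auto simp: mult_le_0_iff)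
      then show ?thesis by (simp add: f_def flat_def)
    qed
  qed
qed

text \<open>On \<Omega>_T the factor \<theta> is 1, so \<open>u\<close> does not depend on time
  there. The time derivative can be represented by 0, and the norm reduces to two norms of
  \<eta>.\<close>

lemma separable_test_W_M:
  fixes \<Omega> :: "'a::euclidean_space set"
  assumes \<Omega>: "open \<Omega>" and T: "0 < T" and p: "1 < p" and \<eta>: "\<eta> \<in> Cc_infinity \<Omega>"
    and \<theta>: "\<And>k. Ck k \<theta>" "\<And>t. t \<in> {0..T} \<Longrightarrow> \<theta> t = 1" "\<And>t. t \<notin> {- 2..T + 2} \<Longrightarrow> \<theta> t = 0"
  defines "u \<equiv> restrict (\<lambda>z. \<eta> (fst z) * \<theta> (snd z)) (parabolic_domain \<Omega> T)"
    and "G \<equiv> \<lambda>z. \<theta> (snd z) *\<^sub>R grad \<eta> (fst z)"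
  shows "u \<in> test_restrictions \<Omega> T"
    and "W_M \<Omega> T p u G (\<lambda>t w. 0)"
    and "W_M_norm \<Omega> T p u G (\<lambda>t w. 0) =
      Lp_norm (lebesgue_on (parabolic_domain \<Omega> T)) p (\<lambda>z. grad \<eta> (fst z)) + Lp_norm (lebesgue_on \<Omega>) 2 \<eta>"
proof -
  define v where "v z = \<eta> (fst z) * \<theta> (snd z)" for z
  obtain K where K: "compact K" "K \<subseteq> \<Omega>" "\<And>x. x \<notin> K \<Longrightarrow> \<eta> x = 0"
    using Cc_infinity_support[OF \<eta>] by metis
  note gK = grad_eq_0_off_support[OF Cc_infinity_Ck[OF \<eta>] K(1,3)]
  let ?K = "K \<times> {- 2..T + 2}"
  have cK: "compact ?K" by (intro compact_Times K(1) compact_Icc)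
  have Ckv: "Ck k v" for k
    unfolding v_def
    by (intro Ck_mult Ck_compose_linear[OF bounded_linear_fst] Ck_compose_linear[OF bounded_linear_snd]
        Cc_infinity_Ck[OF \<eta>] \<theta>(1))
  have v0: "v z = 0" if "z \<notin> ?K" for z
    using that K(3) \<theta>(3) by (cases z) (auto simp: v_def)
  have "v \<in> Cc_infinity (\<Omega> \<times> UNIV)"
    by (rule Cc_infinityI[OF Ckv cK]) (use K v0 in auto)
  then show "u \<in> test_restrictions \<Omega> T"
    unfolding test_restrictions_def u_def v_def[symmetric] by (rule imageI)
  have oD: "open (parabolic_domain \<Omega> T)"
    using \<Omega> by (simp add: parabolic_domain_def open_Times)
  then have bD: "parabolic_domain \<Omega> T \<in> sets borel" by simp
  have uv: "u z = v z" if "z \<in> parabolic_domain \<Omega> T" for z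
    using that by (simp add: u_def v_def)
  have u\<eta>: "u (x, t) = \<eta> x" if "x \<in> \<Omega>" "t \<in> {0<..<T}" for x t
    using that \<theta>(2)[of t] by (simp add: u_def parabolic_domain_def)
  have cv: "continuous_on UNIV v" using Ckv[of 0] by simp
  have c\<eta>: "continuous_on UNIV \<eta>" using Cc_infinity_Ck[OF \<eta>, of 0] by simp
  have c\<theta>: "continuous_on UNIV \<theta>" using \<theta>(1)[of 0] by simp
  have cg: "continuous_on UNIV (grad \<eta>)" by (rule continuous_grad[OF Cc_infinity_Ck[OF \<eta>]])
  have cG: "continuous_on UNIV G"
    unfolding G_def
    by (intro continuous_on_scaleR continuous_on_compose2[OF c\<theta>] continuous_on_compose2[OF cg]
        continuous_intros) auto
  have G0: "G z = 0" if "z \<notin> ?K" for z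
    using that gK \<theta>(3) by (cases z) (auto simp: G_def)
  have AE_space: "AE t in lebesgue_on {0<..<T}. P t" if "\<And>t. t \<in> {0<..<T} \<Longrightarrow> P t" for P :: "real \<Rightarrow> bool"
    using that by (intro AE_I2) auto
  have W: "W1p_0 \<Omega> p \<eta> (grad \<eta>)"
    using \<Omega> p \<eta> by (intro W1p_0_test_function) auto
  have Lpu: "Lp (lebesgue_on (parabolic_domain \<Omega> T)) p u"
    using Lp_compact_support[OF cv cK v0 bD, of p] p Lp_cong[of "parabolic_domain \<Omega> T" u v p, OF uv] by simp
  have "in_Lp_W1p_0 \<Omega> T p u G"
    unfolding in_Lp_W1p_0_def
  proof (intro conjI AE_space Lpu)
    show "Lp (lebesgue_on (parabolic_domain \<Omega> T)) p G"
      using Lp_compact_support[OF cG cK G0 bD, of p] p by simp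
    fix t assume t: "t \<in> {0<..<T}"
    have "(\<lambda>x. G (x, t)) = grad \<eta>"
      using \<theta>(2)[of t] t by (simp add: G_def)
    then show "W1p_0 \<Omega> p (\<lambda>x. u (x, t)) (\<lambda>x. G (x, t))"
      using W W1p_0_cong[of \<Omega> "\<lambda>x. u (x, t)" \<eta> p "grad \<eta>"] u\<eta> t by simp
  qed
  have L2: "Lp_norm (lebesgue_on \<Omega>) 2 (\<lambda>x. u (x, t)) = Lp_norm (lebesgue_on \<Omega>) 2 \<eta>" if "t \<in> {0<..<T}" for t
    using u\<eta> that by (intro Lp_norm_cong) auto
  have Linf: "Linf_L2_norm \<Omega> T u = ereal (Lp_norm (lebesgue_on \<Omega>) 2 \<eta>)"
  proof -
    have "(\<lambda>t. ereal (Lp_norm (lebesgue_on \<Omega>) 2 (\<lambda>x. u (x, t)))) \<in> borel_measurable (lebesgue_on {0<..<T})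
        \<longleftrightarrow> (\<lambda>t. ereal (Lp_norm (lebesgue_on \<Omega>) 2 \<eta>)) \<in> borel_measurable (lebesgue_on {0<..<T})"
      using L2 by (intro measurable_cong) auto
    then have "Linf_L2_norm \<Omega> T u = esssup (lebesgue_on {0<..<T}) (\<lambda>t. ereal (Lp_norm (lebesgue_on \<Omega>) 2 \<eta>))"
      unfolding Linf_L2_norm_def using L2 by (intro esssup_AE_cong AE_space) auto
    \<comment> \<open>Since T > 0, the time interval is not null and the essential supremum of a
      constant is that constant.\<close>
    also have "\<dots> = ereal (Lp_norm (lebesgue_on \<Omega>) 2 \<eta>)"
      using T by (intro esssup_const) (simp add: emeasure_restrict_space)
    finally show ?thesis .
  qed
  have "in_Linf_L2 \<Omega> T u"
    unfolding in_Linf_L2_def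
  proof (intro conjI AE_space)
    show "u \<in> borel_measurable (lebesgue_on (parabolic_domain \<Omega> T))"
      using Lpu by (simp add: Lp_def)
    show "Linf_L2_norm \<Omega> T u < \<infinity>" by (simp add: Linf)
    fix t assume t: "t \<in> {0<..<T}"
    show "Lp (lebesgue_on \<Omega>) 2 (\<lambda>x. u (x, t))"
      using Lp_compact_support[OF c\<eta> K(1,3), of \<Omega> 2] \<Omega> Lp_cong[of \<Omega> "\<lambda>x. u (x, t)" \<eta> 2] u\<eta> t by simp
  qed
  \<comment> \<open>\<open>Sup\<close> on the reals has no useful value on the empty set, so the
    unit ball must first be shown to be inhabited; the zero function belongs to it.\<close>
  have dual0: "dual_norm \<Omega> p (\<lambda>w. 0) = 0"
  proof -
    have "W1p_0 \<Omega> p (\<lambda>x. 0) (grad (\<lambda>x. 0))"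
      using \<Omega> p by (intro W1p_0_test_function Cc_infinity_zero) auto
    moreover have "grad (\<lambda>x::'a. 0) = (\<lambda>x. 0)"
      by (rule ext, rule grad_eqI) simp
    ultimately have "W1p_0 \<Omega> p (\<lambda>x. 0) (\<lambda>x. 0)" by simp
    moreover have "Lp_norm (lebesgue_on \<Omega>) p (\<lambda>x::'a. 0::'a) \<le> 1" by (simp add: Lp_norm_def)
    ultimately have "{\<bar>0::real\<bar> | w G. W1p_0 \<Omega> p w G \<and> Lp_norm (lebesgue_on \<Omega>) p G \<le> 1} = {0}" by auto
    then show ?thesis by (simp only: dual_norm_def) simp
  qed
  have "in_Lp_dual \<Omega> T p (\<lambda>t w. 0)"
    unfolding in_Lp_dual_def
  proof (intro conjI AE_space)
    show "W1p_0_dual \<Omega> p (\<lambda>w. 0)"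
      unfolding W1p_0_dual_def by (intro conjI exI[of _ 0]) auto
    show "Lp (lebesgue_on {0<..<T}) (conj_exp p) (\<lambda>t. dual_norm \<Omega> p (\<lambda>w. 0))"
      by (simp add: dual0 Lp_def)
  qed simp
  moreover have "weak_time_deriv \<Omega> T u (\<lambda>t w. 0)"
    unfolding weak_time_deriv_def
  proof
    fix \<psi> assume \<psi>: "\<psi> \<in> Cc_infinity (parabolic_domain \<Omega> T)"
    obtain H where H: "compact H" "H \<subseteq> parabolic_domain \<Omega> T" "\<And>z. z \<notin> H \<Longrightarrow> \<psi> z = 0"
      using Cc_infinity_support[OF \<psi>] by metis
    \<comment> \<open>The derivative of \<eta>(x) \<psi>(x,t), which is smooth on all of space-time,
      unlike \<open>u\<close> \<psi> with its restricted factor. In direction \<open>(0, 1)\<close>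
      the term with the derivative of \<eta> drops out.\<close>
    define D where "D z w = \<eta> (fst z) * frechet_derivative \<psi> (at z) w +
        frechet_derivative \<eta> (at (fst z)) (fst w) * \<psi> z" for z w
    have Dt: "D z (0, 1) = \<eta> (fst z) * time_deriv \<psi> z" for z
      using has_derivative_linear[OF Cc_infinity_derivative[OF \<eta>], of "fst z"]
      by (simp add: D_def time_deriv_def linear_0)
    have ct: "continuous_on UNIV (\<lambda>z. \<eta> (fst z) * time_deriv \<psi> z)"
      unfolding time_deriv_def using Cc_infinity_Ck[OF \<psi>, of "Suc 0"]
      by (intro continuous_on_mult continuous_on_compose2[OF c\<eta>] continuous_intros) auto
    have t0: "time_deriv \<psi> z = 0" if "z \<notin> H" for z
      using has_derivative_eq_0_off_support[OF Cc_infinity_derivative[OF \<psi>] H(1,3) that]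
      by (simp add: time_deriv_def)
    have "(\<integral>z. u z * time_deriv \<psi> z \<partial>lebesgue_on (parabolic_domain \<Omega> T)) =
        (\<integral>z. \<eta> (fst z) * time_deriv \<psi> z \<partial>lebesgue_on (parabolic_domain \<Omega> T))"
      using u\<eta> by (intro Bochner_Integration.integral_cong refl) (auto simp: parabolic_domain_def)
    also have "\<dots> = (\<integral>z. \<eta> (fst z) * time_deriv \<psi> z \<partial>lborel)"
      using t0 H(2) by (intro integral_lebesgue_on_eq_lborel borel_measurable_continuous_onI ct bD) auto
    also have "\<dots> = (\<integral>z. D z (0, 1) \<partial>lborel)" by (simp add: Dt)
    also have "\<dots> = 0"
    proof (rule integral_directional_derivative_eq_0[OF _ _ H(1)])
      show "((\<lambda>z. \<eta> (fst z) * \<psi> z) has_derivative D z) (at z)" for z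
        unfolding D_def
        by (intro has_derivative_mult Cc_infinity_derivative[OF \<psi>]
            has_derivative_compose[OF _ Cc_infinity_derivative[OF \<eta>]] derivative_intros)
      show "continuous_on UNIV (\<lambda>z. D z (0, 1))" unfolding Dt by (rule ct)
    qed (use H in auto)
    finally show "(\<integral>z. u z * time_deriv \<psi> z \<partial>lebesgue_on (parabolic_domain \<Omega> T)) =
        - (\<integral>t. 0 \<partial>lebesgue_on {0<..<T})" by simp
  qed
  ultimately show "W_M \<Omega> T p u G (\<lambda>t w. 0)"
    using \<open>in_Lp_W1p_0 \<Omega> T p u G\<close> \<open>in_Linf_L2 \<Omega> T u\<close> by (simp add: W_M_def)
  have "Lp_norm (lebesgue_on (parabolic_domain \<Omega> T)) p G =
      Lp_norm (lebesgue_on (parabolic_domain \<Omega> T)) p (\<lambda>z. grad \<eta> (fst z))"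
    using \<theta>(2) by (intro Lp_norm_cong) (auto simp: G_def parabolic_domain_def)
  moreover have "Lp_norm (lebesgue_on {0<..<T}) (conj_exp p) (\<lambda>t. dual_norm \<Omega> p (\<lambda>w. 0)) = 0"
    by (simp add: dual0 Lp_norm_def)
  ultimately show "W_M_norm \<Omega> T p u G (\<lambda>t w. 0) =
      Lp_norm (lebesgue_on (parabolic_domain \<Omega> T)) p (\<lambda>z. grad \<eta> (fst z)) + Lp_norm (lebesgue_on \<Omega>) 2 \<eta>"
    by (simp add: W_M_norm_def Linf)
qed

section \<open>The measure on a line\<close>

text \<open>Finite Borel measures on a Polish space are inner regular. The push-forward of \<mu>
  under inclusion is such a measure and agrees with \<mu> on Borel subsets of
  \<open>X\<close>.\<close>

lemma finite_radon_measure_onI: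
  fixes \<mu> :: "'a::{second_countable_topology, complete_space} measure"
  assumes X: "X \<in> sets borel" and sets: "sets \<mu> = sets (restrict_space borel X)" and fin: "finite_measure \<mu>"
  shows "finite_radon_measure_on X \<mu>"
  unfolding finite_radon_measure_on_def
proof (intro conjI ballI sets fin)
  interpret finite_measure \<mu> by (rule fin)
  define \<nu> where "\<nu> = distr \<mu> borel (\<lambda>x. x)"
  have sp: "space \<mu> = X"
    using sets_eq_imp_space_eq[OF sets] by (simp add: space_restrict_space)
  have meas: "(\<lambda>x. x) \<in> measurable \<mu> borel"
    unfolding measurable_cong_sets[OF sets refl] by (rule measurable_restrict_space1) simp
  have mem: "B \<in> sets \<mu> \<longleftrightarrow> B \<subseteq> X \<and> B \<in> sets borel" for B
    unfolding sets using X by (subst sets_restrict_space_iff) auto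
  have eq: "emeasure \<nu> B = emeasure \<mu> B" if "B \<in> sets borel" "B \<subseteq> X" for B
    using that meas by (simp add: \<nu>_def emeasure_distr sp Int_absorb2)
  fix B assume "B \<in> sets \<mu>"
  then have B: "B \<subseteq> X" "B \<in> sets borel" by (simp_all add: mem)
  have "emeasure \<nu> B = (SUP K\<in>{K. K \<subseteq> B \<and> compact K}. emeasure \<nu> K)"
  proof (rule inner_regular)
    show "emeasure \<nu> (space \<nu>) \<noteq> \<infinity>"
      using meas sp by (simp add: \<nu>_def emeasure_distr)
  qed (use B in \<open>auto simp: \<nu>_def\<close>)
  also have "\<dots> = (SUP K\<in>{K. K \<subseteq> B \<and> compact K}. emeasure \<mu> K)"
    using B by (intro SUP_cong refl eq) (auto intro: borel_compact)
  finally show "emeasure \<mu> B = (SUP K\<in>{K. K \<subseteq> B \<and> compact K}. emeasure \<mu> K)"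
    using eq B by simp
qed

text \<open>Identifies the sigma-algebra of the product measure with the Borel sets of \<Omega>_T.
  For the harder inclusion, a Borel subset of the rectangle is its own preimage under the inclusion
  map, which is measurable into the product of the two Borel spaces.\<close>

lemma sets_pair_restrict_space_borel:
  fixes A :: "'a::second_countable_topology set" and B :: "'b::second_countable_topology set"
  assumes "A \<in> sets borel" and "B \<in> sets borel"
  shows "sets (restrict_space borel A \<Otimes>\<^sub>M restrict_space borel B) = sets (restrict_space borel (A \<times> B))"
proof (intro equalityI)
  have AB: "A \<times> B \<in> sets borel"
    using pair_measureI[OF assms] unfolding borel_prod .
  have mem: "C \<in> sets (restrict_space borel (A \<times> B)) \<longleftrightarrow> C \<subseteq> A \<times> B \<and> C \<in> sets borel" for C
    using AB by (subst sets_restrict_space_iff) auto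
  show "sets (restrict_space borel A \<Otimes>\<^sub>M restrict_space borel B) \<subseteq> sets (restrict_space borel (A \<times> B))"
  proof (rule sets_pair_in_sets)
    fix a b assume "a \<in> sets (restrict_space borel A)" "b \<in> sets (restrict_space borel B)"
    then have "a \<subseteq> A" "b \<subseteq> B" "a \<in> sets borel" "b \<in> sets borel"
      using assms by (auto simp: sets_restrict_space_iff)
    then show "a \<times> b \<in> sets (restrict_space borel (A \<times> B))"
      using pair_measureI[of a borel b borel] unfolding mem borel_prod by blast
  qed
  show "sets (restrict_space borel (A \<times> B)) \<subseteq> sets (restrict_space borel A \<Otimes>\<^sub>M restrict_space borel B)"
  proof
    fix C assume "C \<in> sets (restrict_space borel (A \<times> B))"
    then have C: "C \<subseteq> A \<times> B" "C \<in> sets (borel \<Otimes>\<^sub>M borel)"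
      unfolding mem borel_prod by blast+
    have "(\<lambda>z. (fst z, snd z)) \<in> (restrict_space borel A \<Otimes>\<^sub>M restrict_space borel B) \<rightarrow>\<^sub>M (borel \<Otimes>\<^sub>M borel)"
      by (intro measurable_Pair measurable_compose[OF measurable_fst] measurable_compose[OF measurable_snd]
          measurable_restrict_space1) auto
    from measurable_sets[OF this C(2)] C(1)
    show "C \<in> sets (restrict_space borel A \<Otimes>\<^sub>M restrict_space borel B)"
      by (simp add: space_pair_measure space_restrict_space Int_absorb2 vimage_def)
  qed
qed

section \<open>Mass, cylinder bounds and integrals for the line measure\<close>

context
  fixes \<Omega> :: "'a::euclidean_space set" and x0 :: 'a and J :: "real set" and T :: real
    and \<mu> :: "('a \<times> real) measure"
  assumes \<Omega>: "open \<Omega>" and x0: "x0 \<in> \<Omega>" and J: "open J" "J \<subseteq> {0<..<T}"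
    and \<mu>: "\<mu> = return (restrict_space borel \<Omega>) x0 \<Otimes>\<^sub>M
              density (restrict_space lborel {0<..<T}) (indicator J)"
begin

lemma sets_line_measure: "sets \<mu> = sets (restrict_space borel (parabolic_domain \<Omega> T))"
proof -
  have "sets \<mu> = sets (restrict_space borel \<Omega> \<Otimes>\<^sub>M restrict_space borel {0<..<T})"
    unfolding \<mu> by (intro sets_pair_measure_cong) (simp_all add: sets_restrict_space)
  then show ?thesis
    using \<Omega> by (simp add: sets_pair_restrict_space_borel parabolic_domain_def)
qed

lemma space_line_measure: "space \<mu> = parabolic_domain \<Omega> T"
  using sets_eq_imp_space_eq[OF sets_line_measure] by (simp add: space_restrict_space)

lemma emeasure_line_measure:
  assumes A: "A \<in> sets borel" "A \<subseteq> \<Omega>" and B: "B \<in> sets borel" "B \<subseteq> {0<..<T}"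
  shows "emeasure \<mu> (A \<times> B) = indicator A x0 * emeasure lborel (J \<inter> B)"
proof -
  let ?N = "density (restrict_space lborel {0<..<T}) (indicator J) :: real measure"
  have emN: "emeasure ?N B = emeasure lborel (J \<inter> B)" if "B \<in> sets borel" "B \<subseteq> {0<..<T}" for B
  proof -
    have BR: "B \<in> sets (restrict_space lborel {0<..<T})" "J \<in> sets (restrict_space lborel {0<..<T})"
      using that J by (auto simp: sets_restrict_space_iff)
    have "emeasure ?N B = (\<integral>\<^sup>+ x. indicator (J \<inter> B) x \<partial>restrict_space lborel {0<..<T})"
      using BR by (simp add: emeasure_density indicator_inter_arith)
    also have "\<dots> = emeasure (restrict_space lborel {0<..<T}) (J \<inter> B)"
      using BR by (intro nn_integral_indicator sets.Int)
    also have "\<dots> = emeasure lborel (J \<inter> B)"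
      using J by (intro emeasure_restrict_space) auto
    finally show ?thesis .
  qed
  have "emeasure lborel (J \<inter> {0<..<T}) \<le> emeasure lborel {0<..<T}"
    by (intro emeasure_mono) auto
  also have "\<dots> < \<infinity>" by (cases "0 \<le> T") auto
  finally have "finite_measure ?N"
    by (intro finite_measureI) (simp add: emN space_restrict_space)
  then interpret N: finite_measure ?N .
  have "emeasure \<mu> (A \<times> B) = emeasure (return (restrict_space borel \<Omega>) x0) A * emeasure ?N B"
    unfolding \<mu> using A B \<Omega>
    by (intro N.emeasure_pair_measure_Times) (auto simp: sets_restrict_space_iff)
  then show ?thesis
    using A B \<Omega> emN[OF B] by (simp add: sets_restrict_space_iff)
qed

lemma emeasure_line_measure_space: "emeasure \<mu> (space \<mu>) = emeasure lborel J"
  using emeasure_line_measure[of \<Omega> "{0<..<T}"] \<Omega> x0 J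
  by (simp add: space_line_measure parabolic_domain_def Int_absorb2)

lemma emeasure_lborel_J_finite: "emeasure lborel J < \<infinity>"
proof -
  have "emeasure lborel J \<le> emeasure lborel {0<..<T}"
    using J by (intro emeasure_mono) auto
  also have "\<dots> < \<infinity>" by (cases "0 \<le> T") auto
  finally show ?thesis .
qed

lemma finite_line_measure: "finite_measure \<mu>"
  using emeasure_lborel_J_finite by (intro finite_measureI) (simp add: emeasure_line_measure_space)

lemma emeasure_line_measure_cylinder_le:
  assumes "s > 0"
  shows "emeasure \<mu> (cylinder r s z \<inter> parabolic_domain \<Omega> T) \<le> ennreal (2 * s)"
proof -
  let ?I = "{snd z - s<..<snd z + s}"
  have "cylinder r s z \<inter> parabolic_domain \<Omega> T = (ball (fst z) r \<inter> \<Omega>) \<times> (?I \<inter> {0<..<T})"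
    by (auto simp: cylinder_def parabolic_domain_def)
  moreover have "emeasure \<mu> ((ball (fst z) r \<inter> \<Omega>) \<times> (?I \<inter> {0<..<T})) =
      indicator (ball (fst z) r \<inter> \<Omega>) x0 * emeasure lborel (J \<inter> (?I \<inter> {0<..<T}))"
    using \<Omega> by (intro emeasure_line_measure) auto
  ultimately have "emeasure \<mu> (cylinder r s z \<inter> parabolic_domain \<Omega> T) =
      indicator (ball (fst z) r \<inter> \<Omega>) x0 * emeasure lborel (J \<inter> (?I \<inter> {0<..<T}))" by metis
  also have "\<dots> \<le> 1 * emeasure lborel ?I"
    by (intro mult_mono emeasure_mono) (auto simp: indicator_def)
  also have "\<dots> = ennreal (2 * s)" using assms by simp
  finally show ?thesis .
qed

text \<open>The complement of the line over \<open>x0\<close> is null, so \<open>f\<close> is almost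
  everywhere constant.\<close>

lemma integral_line_measure:
  fixes f :: "'a \<times> real \<Rightarrow> real"
  assumes f: "f \<in> borel_measurable \<mu>" and c: "\<And>t. t \<in> {0<..<T} \<Longrightarrow> f (x0, t) = c"
  shows "(\<integral>z. f z \<partial>\<mu>) = c * measure lborel J"
proof -
  have "AE z in \<mu>. f z = c"
  proof (rule AE_I)
    show "{z \<in> space \<mu>. \<not> f z = c} \<subseteq> (\<Omega> - {x0}) \<times> {0<..<T}"
      using c by (auto simp: space_line_measure parabolic_domain_def)
    show "emeasure \<mu> ((\<Omega> - {x0}) \<times> {0<..<T}) = 0"
      using \<Omega> by (subst emeasure_line_measure) auto
    have "open ((\<Omega> - {x0}) \<times> {0<..<T})" using \<Omega> by (intro open_Times open_delete) auto
    then show "(\<Omega> - {x0}) \<times> {0<..<T} \<in> sets \<mu>"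
      unfolding sets_line_measure using \<Omega>
      by (subst sets_restrict_space_iff) (auto simp: parabolic_domain_def open_Times)
  qed
  then have "(\<integral>z. f z \<partial>\<mu>) = (\<integral>z. c \<partial>\<mu>)"
    using f by (intro integral_cong_AE) auto
  then show ?thesis
    by (simp add: measure_def emeasure_line_measure_space)
qed

end

text \<open>A bound by \<open>C\<close> would keep the fixed positive number exp(-1) |J| below |C|
  times norms that tend to 0 as \<open>N\<close> grows.\<close>

lemma line_measure_not_in_W_M_dual:
  fixes \<Omega> :: "'a::euclidean_space set"
  assumes n: "DIM('a) \<ge> 2" and \<Omega>: "open \<Omega>" and T: "0 < T" and x0: "x0 \<in> \<Omega>"
    and J: "open J" "J \<noteq> {}" "J \<subseteq> {0<..<T}"
    and \<mu>: "\<mu> = return (restrict_space borel \<Omega>) x0 \<Otimes>\<^sub>M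
              density (restrict_space lborel {0<..<T}) (indicator J)"
  shows "\<not> in_W_M_dual \<Omega> T (real DIM('a)) \<mu>"
proof
  let ?n = "real DIM('a)"
  assume "in_W_M_dual \<Omega> T ?n \<mu>"
  then obtain C where C: "\<And>\<phi> G g. \<phi> \<in> test_restrictions \<Omega> T \<Longrightarrow> W_M \<Omega> T ?n \<phi> G g \<Longrightarrow>
      \<bar>\<integral>z. \<phi> z \<partial>\<mu>\<bar> \<le> C * W_M_norm \<Omega> T ?n \<phi> G g"
    unfolding in_W_M_dual_def by blast
  note ctx = \<Omega> x0 J(1,3) \<mu>
  obtain \<theta> where \<theta>: "\<And>k. Ck k \<theta>" "\<And>t. t \<in> {0..T} \<Longrightarrow> \<theta> t = 1" "\<And>t. t \<notin> {- 2..T + 2} \<Longrightarrow> \<theta> t = 0"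
    using exists_smooth_plateau[OF T] by metis
  obtain R where R: "R > 0" "cball x0 R \<subseteq> \<Omega>"
    using \<Omega> x0 open_contains_cball by metis
  define m where "m = measure lborel J"
  have m: "m > 0"
  proof -
    have "emeasure lborel J \<noteq> 0"
      using open_not_negligible[OF J(1,2)] J(1) by (auto simp: negligible_iff_null_sets null_sets_def)
    then show ?thesis
      using emeasure_lborel_J_finite[OF ctx]
      by (simp add: m_def measure_def enn2real_positive_iff zero_less_iff_neq_zero top.not_eq_extremum)
  qed
  define \<alpha> where "\<alpha> = 8 ^ DIM('a) * unit_ball_vol ?n * T"
  define \<beta> where "\<beta> = 2 * unit_ball_vol ?n * R ^ DIM('a)"
  have bound: "exp (- 1) * m \<le> \<bar>C\<bar> * ((\<alpha> / real N) powr (1 / ?n) + (\<beta> / real N) powr (1 / 2))" if N: "N \<ge> 1" for N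
  proof -
    define \<eta> where "\<eta> = multi_bump x0 R N"
    have \<eta>: "\<eta> \<in> Cc_infinity \<Omega>"
      unfolding \<eta>_def
    proof (rule Cc_infinityI[OF Ck_multi_bump compact_cball R(2)])
      show "multi_bump x0 R N x = 0" if "x \<notin> cball x0 R" for x
        using that by (intro multi_bump_eq_0 R(1)) auto
    qed
    define u where "u = restrict (\<lambda>z. \<eta> (fst z) * \<theta> (snd z)) (parabolic_domain \<Omega> T)"
    have n1: "1 < ?n" using n by simp
    note W = separable_test_W_M[OF \<Omega> T n1 \<eta> \<theta>, folded u_def]
    have "(\<integral>z. u z \<partial>\<mu>) = exp (- 1) * m"
      unfolding m_def
    proof (rule integral_line_measure[OF ctx])
      show "u (x0, t) = exp (- 1)" if "t \<in> {0<..<T}" for t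
        using that x0 \<theta>(2)[of t] N by (simp add: u_def parabolic_domain_def \<eta>_def multi_bump_center)
      have "continuous_on UNIV (\<lambda>z. \<eta> (fst z) * \<theta> (snd z))"
        by (intro Ck_imp_continuous[of 0] Ck_mult Ck_compose_linear[OF bounded_linear_fst]
            Ck_compose_linear[OF bounded_linear_snd] Cc_infinity_Ck[OF \<eta>] \<theta>(1))
      then have "(\<lambda>z. \<eta> (fst z) * \<theta> (snd z)) \<in> borel_measurable (restrict_space borel (parabolic_domain \<Omega> T))"
        by (intro measurable_restrict_space1 borel_measurable_continuous_onI)
      then have "(\<lambda>z. \<eta> (fst z) * \<theta> (snd z)) \<in> borel_measurable \<mu>"
        unfolding measurable_cong_sets[OF sets_line_measure[OF ctx] refl] .
      then show "u \<in> borel_measurable \<mu>"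
        by (rule measurable_cong[THEN iffD1, rotated]) (simp add: u_def space_line_measure[OF ctx])
    qed
    then have "exp (- 1) * m \<le> C * (Lp_norm (lebesgue_on (parabolic_domain \<Omega> T)) ?n (\<lambda>z. grad \<eta> (fst z)) +
        Lp_norm (lebesgue_on \<Omega>) 2 \<eta>)"
      using C[OF W(1,2)] W(3) by simp
    \<comment> \<open>The definition leaves the sign of \<open>C\<close> open; passing to its
      absolute value makes the following monotonicity step valid.\<close>
    also have "\<dots> \<le> \<bar>C\<bar> * (Lp_norm (lebesgue_on (parabolic_domain \<Omega> T)) ?n (\<lambda>z. grad \<eta> (fst z)) +
        Lp_norm (lebesgue_on \<Omega>) 2 \<eta>)"
      by (intro mult_right_mono) (auto simp: Lp_norm_def)
    also have "\<dots> \<le> \<bar>C\<bar> * ((\<alpha> / real N) powr (1 / ?n) + (\<beta> / real N) powr (1 / 2))"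
    proof (intro mult_left_mono add_mono)
      show "Lp_norm (lebesgue_on (parabolic_domain \<Omega> T)) ?n (\<lambda>z. grad \<eta> (fst z)) \<le> (\<alpha> / real N) powr (1 / ?n)"
        unfolding Lp_norm_def \<eta>_def \<alpha>_def
        using integral_norm_grad_multi_bump_powr_le[OF \<Omega> R(1) T _ n, of N x0] N
        by (intro powr_mono2) (auto intro!: Bochner_Integration.integral_nonneg)
      show "Lp_norm (lebesgue_on \<Omega>) 2 \<eta> \<le> (\<beta> / real N) powr (1 / 2)"
        unfolding Lp_norm_def \<eta>_def \<beta>_def
        by (intro powr_mono2 integral_multi_bump_square_le \<Omega> R(1) Bochner_Integration.integral_nonneg) auto
    qed simp
    finally show ?thesis .
  qed
  have null: "(\<lambda>N. (a / real N) powr b) \<longlonglongrightarrow> 0" if "b > 0" "a \<ge> 0" for a b :: real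
    using that lim_const_over_n[of a] by (intro tendsto_zero_powrI[where b = b]) auto
  have "(\<lambda>N. \<bar>C\<bar> * ((\<alpha> / real N) powr (1 / ?n) + (\<beta> / real N) powr (1 / 2))) \<longlonglongrightarrow> \<bar>C\<bar> * (0 + 0)"
    using R(1) T n by (intro tendsto_intros null) (auto simp: \<alpha>_def \<beta>_def unit_ball_vol_nonneg)
  then have "exp (- 1) * m \<le> \<bar>C\<bar> * (0 + 0)"
    by (rule LIMSEQ_le_const) (use bound in blast)
  with m show False by (simp add: mult_le_0_iff)
qed

theorem mainTheorem3:
  fixes \<Omega> :: "(real ^ 'n) set" and x0 :: "real ^ 'n" and J :: "real set"
    and T p :: real and \<mu> :: "((real ^ 'n) \<times> real) measure"
  assumes "CARD('n) \<ge> 2" and "p = real CARD('n)"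
    and "bounded_lipschitz_domain \<Omega>" and "0 < T" and "x0 \<in> \<Omega>"
    and "open J" and "is_interval J" and "J \<noteq> {}"
    and "compact (closure J)" and "closure J \<subseteq> {0<..<T}"
    and "\<mu> = return (restrict_space borel \<Omega>) x0 \<Otimes>\<^sub>M
              density (restrict_space lborel {0<..<T}) (indicator J)"
  shows "finite_radon_measure_on (parabolic_domain \<Omega> T) \<mu> \<and>
    (\<forall>q>1. \<forall>z\<in>parabolic_domain \<Omega> T. \<forall>r>0.
       emeasure \<mu> (cylinder r (r powr q) z \<inter> parabolic_domain \<Omega> T) \<le> ennreal (2 * r powr q)) \<and>
    (\<forall>q\<ge>p. \<exists>\<theta>. \<theta> = p \<and> p = min p q \<and>
       (\<exists>M>0. \<forall>z\<in>parabolic_domain \<Omega> T. \<forall>r>0.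
          emeasure \<mu> (cylinder r (r powr q) z \<inter> parabolic_domain \<Omega> T)
            \<le> ennreal (M * r powr (real CARD('n) + q - \<theta>)))) \<and>
    \<not> in_W_M_dual \<Omega> T p \<mu>"
proof -
  have \<Omega>: "open \<Omega>" using assms(3) by (simp add: bounded_lipschitz_domain_def)
  have J: "J \<subseteq> {0<..<T}" using assms(10) closure_subset by blast
  note ctx = \<Omega> assms(5,6) J assms(11)
  have "parabolic_domain \<Omega> T \<in> sets borel"
    using \<Omega> by (simp add: parabolic_domain_def open_Times)
  then have radon: "finite_radon_measure_on (parabolic_domain \<Omega> T) \<mu>"
    by (rule finite_radon_measure_onI[OF _ sets_line_measure[OF ctx] finite_line_measure[OF ctx]])
  have cyl: "emeasure \<mu> (cylinder r (r powr q) z \<inter> parabolic_domain \<Omega> T) \<le> ennreal (2 * r powr q)"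
    if "r > 0" for r q z
    using that by (intro emeasure_line_measure_cylinder_le[OF ctx]) simp
  have dual: "\<not> in_W_M_dual \<Omega> T p \<mu>"
    using line_measure_not_in_W_M_dual[OF _ \<Omega> assms(4,5,6,8) J assms(11)] assms(1,2) by simp
  show ?thesis
  proof (intro conjI allI impI ballI radon dual)
    show "\<exists>\<theta>. \<theta> = p \<and> p = min p q \<and>
       (\<exists>M>0. \<forall>z\<in>parabolic_domain \<Omega> T. \<forall>r>0.
          emeasure \<mu> (cylinder r (r powr q) z \<inter> parabolic_domain \<Omega> T)
            \<le> ennreal (M * r powr (real CARD('n) + q - \<theta>)))" if "p \<le> q" for q
      \<comment> \<open>With \<theta> = p = n the exponent n + q - \<theta> is q, so the previous
        bound gives M = 2.\<close>
      using that cyl assms(2) by (intro exI[of _ p] conjI exI[of _ 2] ballI allI impI) auto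
  qed (rule cyl)
qed

end
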